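(* The following statements are equivalent for a non-empty set $S$ of infinite cardinals: (i) $S$ is $\omega$-closed and $\sup S\le 2^{\min S}$. (ii) There is a crowded Hausdorff $0$-dimensional CCC space $X$ with $S=dd(X)$. (iii) There is a crowded Hausdorff regular space $X$ with $S=dd(X)$.
   Context: A space is crowded if it has no isolated points; $0$-dimensional means having a base of clopen sets; CCC means that every family of pairwise disjoint non-empty open sets is countable. The density $d(X)$ of a space $X$ is the minimum cardinality of a dense subspace of $X$. $\mathcal{D}(X)$ denotes the family of all dense subspaces of $X$, and $dd(X)=\{d(D): D\in\mathcal{D}(X)\}$ is the double density spectrum of $X$. A set of cardinals is $\omega$-closed if it contains the supremum of each of its non-empty countable subsets. *)

theory Defs
  imports "HOL-Analysis.Analysis"
begin

unbundle cardinal_syntax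

text \<open>
  A set of cardinals is given by a set of cardinal orders on some carrier type, an order standing
  for its class modulo \<open>=o\<close>; several members of the set may stand for the same cardinal.
  All notions below are invariant under \<open>=o\<close>.
\<close>

definition same_cardinals :: "'a rel set \<Rightarrow> 'b rel set \<Rightarrow> bool" where
  "same_cardinals S T \<longleftrightarrow> (\<forall>\<kappa>\<in>S. \<exists>\<mu>\<in>T. \<kappa> =o \<mu>) \<and> (\<forall>\<mu>\<in>T. \<exists>\<kappa>\<in>S. \<kappa> =o \<mu>)"

definition card_min :: "'a rel set \<Rightarrow> 'a rel" where
  "card_min S = (SOME \<mu>. \<mu> \<in> S \<and> (\<forall>\<kappa>\<in>S. \<mu> \<le>o \<kappa>))"

text \<open>
  Cardinals of type \<^typ>\<open>'a rel\<close> suffice as competing upper bounds: the cardinality of the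
  carrier type is itself an upper bound.
\<close>

definition card_sup :: "'a rel set \<Rightarrow> 'a rel" where
  "card_sup S = (SOME \<mu>. Card_order \<mu> \<and> (\<forall>\<kappa>\<in>S. \<kappa> \<le>o \<mu>) \<and>
     (\<forall>\<nu>::'a rel. Card_order \<nu> \<and> (\<forall>\<kappa>\<in>S. \<kappa> \<le>o \<nu>) \<longrightarrow> \<mu> \<le>o \<nu>))"

lemma card_min:
  assumes "S \<noteq> {}" "\<And>\<kappa>. \<kappa> \<in> S \<Longrightarrow> Card_order \<kappa>"
  shows "card_min S \<in> S" and "\<And>\<kappa>. \<kappa> \<in> S \<Longrightarrow> card_min S \<le>o \<kappa>"
proof -
  have "\<exists>\<mu>. \<mu> \<in> S \<and> (\<forall>\<kappa>\<in>S. \<mu> \<le>o \<kappa>)"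
    using exists_minim_Card_order[of S] assms by blast
  from someI_ex[OF this]
  show "card_min S \<in> S" and "\<And>\<kappa>. \<kappa> \<in> S \<Longrightarrow> card_min S \<le>o \<kappa>"
    unfolding card_min_def by blast+
qed

lemma card_sup:
  fixes S :: "'a rel set"
  assumes "\<And>\<kappa>. \<kappa> \<in> S \<Longrightarrow> Card_order \<kappa>"
  shows "Card_order (card_sup S)"
    and "\<And>\<kappa>. \<kappa> \<in> S \<Longrightarrow> \<kappa> \<le>o card_sup S"
    and "\<And>\<nu>::'a rel. Card_order \<nu> \<Longrightarrow> (\<And>\<kappa>. \<kappa> \<in> S \<Longrightarrow> \<kappa> \<le>o \<nu>) \<Longrightarrow> card_sup S \<le>o \<nu>"
proof -
  let ?U = "{\<nu>::'a rel. Card_order \<nu> \<and> (\<forall>\<kappa>\<in>S. \<kappa> \<le>o \<nu>)}"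
  have "\<kappa> \<le>o |UNIV :: 'a set|" if "\<kappa> \<in> S" for \<kappa>
  proof -
    have "\<kappa> =o |Field \<kappa>|"
      using assms[OF that] card_of_Field_ordIso ordIso_symmetric by blast
    then show ?thesis
      using card_of_mono1[of "Field \<kappa>" UNIV] ordIso_ordLeq_trans by blast
  qed
  then have "|UNIV :: 'a set| \<in> ?U"
    using card_of_Card_order by blast
  then have "\<exists>\<mu>\<in>?U. \<forall>\<nu>\<in>?U. \<mu> \<le>o \<nu>"
    by (intro exists_minim_Card_order) blast+
  then obtain \<mu> where "\<mu> \<in> ?U" "\<forall>\<nu>\<in>?U. \<mu> \<le>o \<nu>"
    by auto
  then have "\<exists>\<mu>::'a rel. Card_order \<mu> \<and> (\<forall>\<kappa>\<in>S. \<kappa> \<le>o \<mu>) \<and>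
     (\<forall>\<nu>::'a rel. Card_order \<nu> \<and> (\<forall>\<kappa>\<in>S. \<kappa> \<le>o \<nu>) \<longrightarrow> \<mu> \<le>o \<nu>)"
    by (intro exI[of _ \<mu>]) simp
  from someI_ex[OF this]
  show "Card_order (card_sup S)"
    and "\<And>\<kappa>. \<kappa> \<in> S \<Longrightarrow> \<kappa> \<le>o card_sup S"
    and "\<And>\<nu>::'a rel. Card_order \<nu> \<Longrightarrow> (\<And>\<kappa>. \<kappa> \<in> S \<Longrightarrow> \<kappa> \<le>o \<nu>) \<Longrightarrow> card_sup S \<le>o \<nu>"
    unfolding card_sup_def by blast+
qed

definition omega_closed :: "'a rel set \<Rightarrow> bool" where
  "omega_closed S \<longleftrightarrow>
     (\<forall>A. A \<subseteq> S \<and> A \<noteq> {} \<and> countable A \<longrightarrow> (\<exists>\<mu>\<in>S. \<mu> =o card_sup A))"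

definition dense_subsets :: "'a topology \<Rightarrow> 'a set set" where
  "dense_subsets X = {D. D \<subseteq> topspace X \<and> X closure_of D = topspace X}"

definition density :: "'a topology \<Rightarrow> 'a rel" where
  "density X = card_min (card_of ` dense_subsets X)"

definition dd :: "'a topology \<Rightarrow> 'a rel set" where
  "dd X = (\<lambda>D. density (subtopology X D)) ` dense_subsets X"

definition crowded :: "'a topology \<Rightarrow> bool" where
  "crowded X \<longleftrightarrow> (\<forall>x\<in>topspace X. \<not> openin X {x})"

definition zero_dimensional :: "'a topology \<Rightarrow> bool" where
  "zero_dimensional X \<longleftrightarrow>
     (\<exists>\<B>. (\<forall>B\<in>\<B>. openin X B \<and> closedin X B) \<and>
          (\<forall>U. openin X U \<longrightarrow> (\<exists>\<C>\<subseteq>\<B>. \<Union>\<C> = U)))"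

definition ccc :: "'a topology \<Rightarrow> bool" where
  "ccc X \<longleftrightarrow>
     (\<forall>\<U>. (\<forall>U\<in>\<U>. openin X U \<and> U \<noteq> {}) \<and> pairwise disjnt \<U> \<longrightarrow> countable \<U>)"

text \<open>
  Let \<open>S\<close> be a non-empty set of cardinals of type \<^typ>\<open>'k rel\<close> and \<open>X\<close> a Hausdorff space on any
  type with \<open>S = dd X\<close>. Then \<open>d(X) = min S\<close> is at most the cardinality of \<^typ>\<open>'k\<close>, and \<open>X\<close> has
  at most \<open>2^(2^d(X))\<close> points.
  Hence \<open>X\<close> is homeomorphic to a space with points in \<^typ>\<open>'k set set\<close>, and the existence of
  some such space, on whatever type, is the same as the existence of one on \<^typ>\<open>'k set set\<close>.
\<close>

end

theory Submission
  imports Defs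
begin

text \<open>
  Necessity. The interiors of closures of subsets of a dense set \<open>E\<close> form a \<open>\<pi>\<close>-base of a regular
  space, so all densities are at most \<open>2^|E|\<close>. Given dense sets \<open>E n\<close> of increasing
  densities \<open>\<kappa> n\<close>, one finds disjoint open sets on which the local densities of the \<open>E n\<close> are
  cofinal in the \<open>\<kappa> n\<close>; patching the \<open>E n\<close> together along these realizes the supremum.

  Sufficiency. Let \<open>m = min S\<close>. Take a zero-dimensional space \<open>K\<close> with a base of \<open>m\<close> clopen sets
  forming a ring \<open>Q\<close>, and disjoint closed sets \<open>A \<kappa>\<close> of size \<open>\<kappa>\<close> for \<open>m < \<kappa> \<in> S\<close>. In the Cantor
  cube \<open>2^K\<close>, let \<open>E \<kappa>\<close> consist of the points that are finite on \<open>A \<kappa>\<close> and agree with a member of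
  \<open>Q\<close> elsewhere, and let \<open>X\<close> be the union of the \<open>E \<kappa>\<close>. Each \<open>E \<kappa>\<close> is dense of density \<open>\<kappa>\<close>, and
  its points are locally constant at indices outside \<open>A \<kappa>\<close>. So if the finite conditions can be met
  by points of a dense set \<open>D\<close> whose \<open>A \<kappa>\<close> avoids the indices involved, then \<open>m\<close> points suffice;
  otherwise \<open>D\<close> lies locally in finitely many \<open>E \<kappa>\<close>. Either way the local density of \<open>D\<close> belongs
  to \<open>S\<close>, and by CCC the density of \<open>D\<close> is a countable supremum of local ones. The density does
  not drop below \<open>m\<close> because \<open>K\<close> has a set \<open>Z\<close> of \<open>m\<close> isolated points on which all points of \<open>X\<close>
  are finite.
\<close>

no_notation elt_set_eq (infix "=o" 50)

section \<open>Cardinals\<close>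

lemma ordLeq_if_not_ordLess: "Card_order r \<Longrightarrow> Card_order s \<Longrightarrow> \<not> r <o s \<Longrightarrow> s \<le>o r"
  by (meson card_order_on_def not_ordLess_iff_ordLeq)

text \<open>Sorted by size: a set with \<open>n + 1\<close> elements arises from one with
  \<open>n\<close> by adding a point, so each of the countably many sizes contributes at most
  \<open>|A|\<close> sets.\<close>

lemma card_of_Fpow_ordLeq:
  assumes "infinite A"
  shows "|Fpow A| \<le>o |A|"
proof -
  have small: "|{F. F \<subseteq> A \<and> finite F \<and> card F = n}| \<le>o |A|" for n
  proof (induction n)
    case 0
    have "{F. F \<subseteq> A \<and> finite F \<and> card F = 0} = {{}}"
      by auto
    then show ?case
      using assms by (metis card_of_singl_ordLeq finite.emptyI)
  next
    case (Suc n)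
    let ?P = "A \<times> {F. F \<subseteq> A \<and> finite F \<and> card F = n}"
    have "{F. F \<subseteq> A \<and> finite F \<and> card F = Suc n} \<subseteq> (\<lambda>(a, F). insert a F) ` ?P"
    proof
      fix F assume "F \<in> {F. F \<subseteq> A \<and> finite F \<and> card F = Suc n}"
      then have F: "F \<subseteq> A" "finite F" "card F = Suc n"
        by auto
      then obtain a where "a \<in> F"
        by fastforce
      with F have "F = insert a (F - {a})" "(a, F - {a}) \<in> ?P"
        by auto
      then show "F \<in> (\<lambda>(a, F). insert a F) ` ?P"
        by (intro image_eqI[of _ _ "(a, F - {a})"]) simp_all
    qed
    then have "|{F. F \<subseteq> A \<and> finite F \<and> card F = Suc n}| \<le>o |?P|"
      by (rule surj_imp_ordLeq)
    also have "|?P| \<le>o |A|"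
      using assms Suc ordLeq_refl[OF card_of_Card_order] by (intro card_of_Sigma_ordLeq_infinite) auto
    finally show ?case .
  qed
  have "Fpow A = (\<Union>n. {F. F \<subseteq> A \<and> finite F \<and> card F = n})"
    by (auto simp: Fpow_def)
  moreover have "|\<Union>n. {F. F \<subseteq> A \<and> finite F \<and> card F = n}| \<le>o |A|"
    using assms small by (intro card_of_UNION_ordLeq_infinite) (auto simp: infinite_iff_card_of_nat)
  ultimately show ?thesis
    by simp
qed

text \<open>For infinite \<open>C\<close> the union has size at most \<open>|C|\<close>, for finite
  \<open>C\<close> it is finite; so the bound also covers singular \<open>\<kappa>\<close>.\<close>

lemma card_of_UN_finite_ordLess:
  assumes "Cinfinite \<kappa>" "|C| <o \<kappa>" "\<And>x. x \<in> C \<Longrightarrow> finite (f x)"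
  shows "|\<Union>x\<in>C. f x| <o \<kappa>"
proof (cases "finite C")
  case True
  then show ?thesis
    using assms by (intro Cfinite_ordLess_Cinfinite)
      (auto simp: cfinite_def card_of_card_order_on Field_card_of)
next
  case False
  have "|f x| \<le>o |C|" if "x \<in> C" for x
  proof (rule ordLeq_if_not_ordLess)
    show "\<not> |C| <o |f x|"
      using False assms(3)[OF that] card_of_ordLeq_finite ordLess_imp_ordLeq by blast
  qed (rule card_of_Card_order)+
  then have "|\<Union>x\<in>C. f x| \<le>o |C|"
    using False by (intro card_of_UNION_ordLeq_infinite) (auto simp: ordLeq_refl card_of_Card_order)
  then show ?thesis
    using assms(2) ordLeq_ordLess_trans by blast
qed

lemma card_of_countable_UN_ordLeq:
  assumes "Cinfinite \<kappa>" "countable I" "\<And>i. i \<in> I \<Longrightarrow> |f i| \<le>o \<kappa>"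
  shows "|\<Union>i\<in>I. f i| \<le>o \<kappa>"
proof (rule UNION_Cinfinite_bound)
  have "|I| \<le>o |UNIV :: nat set|"
    using assms(2) unfolding countable_def by (metis card_of_ordLeqI UNIV_I)
  also have "|UNIV :: nat set| \<le>o \<kappa>"
    using assms(1) card_of_nat natLeq_ordLeq_cinfinite ordIso_ordLeq_trans by blast
  finally show "|I| \<le>o \<kappa>" .
qed (use assms in auto)

text \<open>\<open>card_sup\<close> is least only among orders on the type of \<open>S\<close>. A
  smaller bound \<open>\<nu>\<close> on another type would have a copy inside the field of
  \<open>card_sup S\<close>, hence on the type of \<open>S\<close>.\<close>

lemma card_sup_least:
  fixes S :: "'a rel set" and \<nu> :: "'b rel"
  assumes "\<And>\<kappa>. \<kappa> \<in> S \<Longrightarrow> Card_order \<kappa>" "Card_order \<nu>" "\<And>\<kappa>. \<kappa> \<in> S \<Longrightarrow> \<kappa> \<le>o \<nu>"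
  shows "card_sup S \<le>o \<nu>"
proof (rule ccontr)
  assume "\<not> card_sup S \<le>o \<nu>"
  then have "\<nu> <o card_sup S"
    using card_sup(1)[of S] assms(1,2) ordLeq_if_not_ordLess by blast
  then have "|Field \<nu>| \<le>o |Field (card_sup S)|"
    by (simp add: card_of_mono2 ordLess_imp_ordLeq)
  then obtain B where "B \<subseteq> Field (card_sup S)" "|Field \<nu>| =o |B|"
    using internalize_card_of_ordLeq2[of "Field \<nu>" "Field (card_sup S)"] by blast
  then have "\<nu> =o |B|"
    using card_of_Field_ordIso[OF assms(2)] ordIso_symmetric ordIso_transitive by blast
  then have "card_sup S \<le>o |B|"
    using assms card_sup(3)[of S "|B|"] card_of_Card_order ordLeq_ordIso_trans by blast
  then have "card_sup S \<le>o \<nu>"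
    using \<open>\<nu> =o |B|\<close> ordIso_symmetric ordLeq_ordIso_trans by blast
  then show False
    using \<open>\<not> card_sup S \<le>o \<nu>\<close> by blast
qed

section \<open>Dense subsets and density\<close>

lemma dense_subsets_iff:
  "D \<in> dense_subsets X \<longleftrightarrow>
     D \<subseteq> topspace X \<and> (\<forall>U. openin X U \<and> U \<noteq> {} \<longrightarrow> D \<inter> U \<noteq> {})"
  unfolding dense_subsets_def dense_intersects_open by simp

lemma topspace_in_dense_subsets: "topspace X \<in> dense_subsets X"
  by (simp add: dense_subsets_def)

text \<open>Lets the density of a dense subspace be computed with dense subsets of the whole space:
  nonempty open sets of \<open>X\<close> have nonempty traces on \<open>D\<close>.\<close>

lemma dense_subsets_subtopology:
  assumes "D \<in> dense_subsets X"
  shows "C \<in> dense_subsets (subtopology X D) \<longleftrightarrow> C \<subseteq> D \<and> C \<in> dense_subsets X"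
proof
  assume C: "C \<in> dense_subsets (subtopology X D)"
  then have "C \<subseteq> D"
    by (auto simp: dense_subsets_iff)
  moreover have "C \<inter> U \<noteq> {}" if "openin X U \<and> U \<noteq> {}" for U
  proof -
    have "openin (subtopology X D) (D \<inter> U)" "D \<inter> U \<noteq> {}"
      using that assms by (auto simp: dense_subsets_iff openin_subtopology)
    then have "C \<inter> (D \<inter> U) \<noteq> {}"
      using C unfolding dense_subsets_iff by blast
    then show ?thesis
      by blast
  qed
  ultimately show "C \<subseteq> D \<and> C \<in> dense_subsets X"
    using C by (auto simp: dense_subsets_iff)
next
  assume C: "C \<subseteq> D \<and> C \<in> dense_subsets X"
  have "C \<inter> U \<noteq> {}" if U: "openin (subtopology X D) U \<and> U \<noteq> {}" for U
  proof -
    obtain T where T: "openin X T" "U = T \<inter> D"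
      using U by (auto simp: openin_subtopology)
    with U have "C \<inter> T \<noteq> {}"
      using C unfolding dense_subsets_iff by blast
    then show ?thesis
      using C T by blast
  qed
  then show "C \<in> dense_subsets (subtopology X D)"
    using C by (auto simp: dense_subsets_iff)
qed

lemma density_in: "density X \<in> card_of ` dense_subsets X"
  unfolding density_def
proof (rule card_min(1))
  show "card_of ` dense_subsets X \<noteq> {}"
    using topspace_in_dense_subsets by blast
qed (auto simp: card_of_Card_order)

lemma density_ordLeq: "C \<in> dense_subsets X \<Longrightarrow> density X \<le>o |C|"
  unfolding density_def by (rule card_min(2)) (auto simp: card_of_Card_order)

lemma density_subtopology_obtains:
  assumes "D \<in> dense_subsets X"
  obtains C where "C \<subseteq> D" "C \<in> dense_subsets X" "density (subtopology X D) = |C|"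
proof -
  obtain C where "C \<in> dense_subsets (subtopology X D)" "density (subtopology X D) = |C|"
    using density_in[of "subtopology X D"] by (rule imageE)
  then show thesis
    using that[of C] dense_subsets_subtopology[OF assms] by simp
qed

lemma density_subtopology_ordLeq:
  assumes "D \<in> dense_subsets X" "C \<in> dense_subsets X" "C \<subseteq> D"
  shows "density (subtopology X D) \<le>o |C|"
  using assms dense_subsets_subtopology[OF assms(1)] by (simp add: density_ordLeq)

lemma density_subtopology_ordIsoI:
  fixes \<kappa> :: "'b rel"
  assumes "D \<in> dense_subsets X" "C \<in> dense_subsets X" "C \<subseteq> D" "|C| \<le>o \<kappa>"
    and "\<And>C. C \<in> dense_subsets X \<Longrightarrow> C \<subseteq> D \<Longrightarrow> \<kappa> \<le>o |C|"
  shows "\<kappa> =o density (subtopology X D)"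
proof -
  obtain C' where "C' \<subseteq> D" "C' \<in> dense_subsets X" "density (subtopology X D) = |C'|"
    using density_subtopology_obtains[OF assms(1)] .
  moreover have "density (subtopology X D) \<le>o \<kappa>"
    using density_subtopology_ordLeq[OF assms(1-3)] assms(4) ordLeq_transitive by blast
  ultimately show ?thesis
    using assms(5) by (simp add: ordIso_iff_ordLeq)
qed

lemma zero_dimensional_imp_regular_space:
  assumes "zero_dimensional X"
  shows "regular_space X"
  unfolding regular_space_def
proof (intro allI impI)
  fix C a assume "closedin X C \<and> a \<in> topspace X - C"
  then have C: "C \<subseteq> topspace X" and op: "openin X (topspace X - C)" and a: "a \<in> topspace X - C"
    by (auto simp: closedin_def)
  obtain \<B> where \<B>: "\<forall>B\<in>\<B>. openin X B \<and> closedin X B" "\<exists>\<C>\<subseteq>\<B>. \<Union>\<C> = topspace X - C"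
    using assms op unfolding zero_dimensional_def by meson
  then obtain B where "B \<in> \<B>" "a \<in> B" "B \<subseteq> topspace X - C"
    using a by blast
  with \<B>(1) C show "\<exists>U V. openin X U \<and> openin X V \<and> a \<in> U \<and> C \<subseteq> V \<and> disjnt U V"
    by (intro exI[of _ B] exI[of _ "topspace X - B"]) (auto simp: disjnt_def)
qed

section \<open>The double density spectrum of crowded Hausdorff and regular spaces\<close>

text \<open>Every nonempty open set includes a nonempty set
  \<open>X interior_of (X closure_of T)\<close> with \<open>T \<subseteq> E\<close>, so one point of
  \<open>D\<close> from each of these sets is enough.\<close>

lemma regular_space_dense_ordLeq_Pow:
  assumes "regular_space X" "E \<in> dense_subsets X" "D \<in> dense_subsets X"
  obtains C where "C \<subseteq> D" "C \<in> dense_subsets X" "|C| \<le>o |Pow E|"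
proof -
  define I where "I T = D \<inter> X interior_of (X closure_of T)" for T
  define C where "C = (\<lambda>T. SOME x. x \<in> I T) ` {T \<in> Pow E. I T \<noteq> {}}"
  have pick: "(SOME x. x \<in> I T) \<in> I T" if "I T \<noteq> {}" for T
    using that by (simp add: some_in_eq)
  then have "C \<subseteq> D"
    unfolding C_def I_def by blast
  moreover have "C \<in> dense_subsets X"
    unfolding dense_subsets_iff
  proof (intro conjI allI impI)
    show "C \<subseteq> topspace X"
      using \<open>C \<subseteq> D\<close> assms(3) by (auto simp: dense_subsets_iff)
    fix U assume U: "openin X U \<and> U \<noteq> {}"
    then obtain x where x: "x \<in> U"
      by blast
    with U have "closedin X (topspace X - U)" "x \<in> topspace X - (topspace X - U)"
      using openin_subset by fastforce+
    with assms(1) obtain V W where VW: "openin X V" "openin X W" "x \<in> V" "topspace X - U \<subseteq> W" "disjnt V W"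
      unfolding regular_space_def by meson
    \<comment> \<open>The choice \<open>T = E \<inter> V\<close> works: its closure lies in the
      closed set \<open>topspace X - W\<close>, hence in \<open>U\<close>, and contains
      \<open>V\<close> because \<open>E\<close> is dense.\<close>
    have "X closure_of (E \<inter> V) \<subseteq> topspace X - W"
      using VW by (intro closure_of_minimal) (auto simp: disjnt_iff dest: openin_subset)
    then have sub: "X closure_of (E \<inter> V) \<subseteq> U"
      using VW(4) by blast
    have "V \<subseteq> X closure_of (E \<inter> V)"
    proof
      fix v assume v: "v \<in> V"
      have "\<exists>y. y \<in> E \<inter> V \<and> y \<in> T" if "v \<in> T" "openin X T" for T
      proof -
        have "E \<inter> (T \<inter> V) \<noteq> {}"
          using assms(2) that v VW(1) unfolding dense_subsets_iff by blast
        then show ?thesis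
          by blast
      qed
      then show "v \<in> X closure_of (E \<inter> V)"
        using v VW(1) by (auto simp: in_closure_of dest: openin_subset)
    qed
    then have "V \<subseteq> X interior_of (X closure_of (E \<inter> V))"
      using VW(1) by (simp add: interior_of_maximal)
    moreover have "D \<inter> V \<noteq> {}"
      using assms(3) VW(1,3) unfolding dense_subsets_iff by blast
    ultimately have ne: "I (E \<inter> V) \<noteq> {}"
      unfolding I_def by blast
    then have "(SOME x. x \<in> I (E \<inter> V)) \<in> C"
      unfolding C_def by blast
    moreover have "(SOME x. x \<in> I (E \<inter> V)) \<in> U"
      using pick[OF ne] sub interior_of_subset unfolding I_def by fastforce
    ultimately show "C \<inter> U \<noteq> {}"
      by blast
  qed
  moreover have "|C| \<le>o |Pow E|"
    unfolding C_def using card_of_image card_of_mono1 ordLeq_transitive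
    by (metis (no_types, lifting) mem_Collect_eq subsetI)
  ultimately show thesis
    using that by blast
qed

section \<open>Disjoint families of open sets\<close>

text \<open>By Zorn's lemma: a nonempty open set missing the union of a maximal family would contain
  one more admissible member.\<close>

lemma maximal_disjoint_open_family:
  assumes "\<And>G. openin X G \<Longrightarrow> G \<noteq> {} \<Longrightarrow> \<exists>V. openin X V \<and> V \<noteq> {} \<and> V \<subseteq> G \<and> P V"
  obtains \<V> where "\<And>V. V \<in> \<V> \<Longrightarrow> openin X V \<and> V \<noteq> {} \<and> P V" "pairwise disjnt \<V>"
    "\<Union>\<V> \<in> dense_subsets X"
proof -
  let ?A = "{\<V>. (\<forall>V\<in>\<V>. openin X V \<and> V \<noteq> {} \<and> P V) \<and> pairwise disjnt \<V>}"
  have "\<Union>\<C> \<in> ?A" if "subset.chain ?A \<C>" for \<C>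
  proof -
    have "pairwise disjnt (\<Union>\<C>)"
      using that by (intro pairwise_chain_Union) (auto simp: subset_chain_def chain_subset_def)
    then show ?thesis
      using that by (auto simp: subset_chain_def)
  qed
  then have "\<exists>\<V>\<in>?A. \<forall>\<W>\<in>?A. \<V> \<subseteq> \<W> \<longrightarrow> \<W> = \<V>"
    by (rule subset_Zorn')
  then obtain \<V> where \<V>: "\<V> \<in> ?A" and max: "\<forall>\<W>\<in>?A. \<V> \<subseteq> \<W> \<longrightarrow> \<W> = \<V>"
    by (rule bexE)
  have "\<Union>\<V> \<in> dense_subsets X"
    unfolding dense_subsets_iff
  proof (intro conjI allI impI notI)
    show "\<Union>\<V> \<subseteq> topspace X"
      using \<V> openin_subset by fastforce
    fix G assume G: "openin X G \<and> G \<noteq> {}" "\<Union>\<V> \<inter> G = {}"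
    then obtain V where V: "openin X V" "V \<noteq> {}" "V \<subseteq> G" "P V"
      using assms[of G] by auto
    with \<V> G have "insert V \<V> \<in> ?A"
      by (auto simp: pairwise_insert disjnt_iff)
    then have "insert V \<V> = \<V>"
      by (rule max[rule_format]) auto
    then have "V \<in> \<V>"
      by auto
    then show False
      using V G by blast
  qed
  with \<V> show thesis
    using that[of \<V>] by simp
qed

text \<open>Without isolated points a nonempty open set contains two disjoint nonempty open subsets;
  one is kept as \<open>V n\<close>, the other is split further.\<close>

lemma crowded_Hausdorff_disjoint_open_sequence:
  assumes "crowded X" "Hausdorff_space X" "openin X G" "G \<noteq> {}"
  obtains V :: "nat \<Rightarrow> 'a set" where "\<And>n. openin X (V n)" "\<And>n. V n \<noteq> {}" "\<And>n. V n \<subseteq> G"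
    "\<And>i j. i \<noteq> j \<Longrightarrow> disjnt (V i) (V j)"
proof -
  have split: "\<exists>V W'. openin X V \<and> V \<noteq> {} \<and> V \<subseteq> W \<and> openin X W' \<and> W' \<noteq> {} \<and> W' \<subseteq> W \<and> disjnt V W'"
    if W: "openin X W" "W \<noteq> {}" for W
  proof -
    obtain x where "x \<in> W"
      using W by blast
    moreover have "W \<noteq> {x}"
      using assms(1) W openin_subset unfolding crowded_def by fastforce
    ultimately obtain y where "y \<in> W" "x \<noteq> y"
      by blast
    with \<open>x \<in> W\<close> W have "x \<in> topspace X" "y \<in> topspace X"
      using openin_subset by blast+
    with \<open>x \<noteq> y\<close> assms(2) obtain V V' where V: "openin X V" "openin X V'" "x \<in> V" "y \<in> V'" "disjnt V V'"
      unfolding Hausdorff_space_def by metis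
    show ?thesis
      by (rule exI[of _ "V \<inter> W"], rule exI[of _ "V' \<inter> W"])
        (use V W \<open>x \<in> W\<close> \<open>y \<in> W\<close> in \<open>auto simp: disjnt_iff\<close>)
  qed
  define P where "P W \<longleftrightarrow> openin X W \<and> W \<noteq> {} \<and> W \<subseteq> G" for W
  define Q where "Q W W' \<longleftrightarrow> W' \<subseteq> W \<and> (\<exists>V. openin X V \<and> V \<noteq> {} \<and> V \<subseteq> W \<and> disjnt V W')" for W W'
  have "\<exists>W. \<forall>n::nat. P (W n) \<and> Q (W n) (W (Suc n))"
  proof (rule dependent_nat_choice)
    show "\<exists>W. P W"
      using assms(3,4) unfolding P_def by blast
    fix W assume W: "P W"
    then obtain V W' where "openin X V" "V \<noteq> {}" "V \<subseteq> W" "openin X W'" "W' \<noteq> {}" "W' \<subseteq> W" "disjnt V W'"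
      using split[of W] unfolding P_def by auto
    with W have "P W' \<and> Q W W'"
      unfolding P_def Q_def by auto
    then show "\<exists>W'. P W' \<and> Q W W'" ..
  qed
  then obtain W where "\<forall>n::nat. P (W n) \<and> Q (W n) (W (Suc n))" ..
  then have W: "\<And>n. openin X (W n) \<and> W n \<noteq> {} \<and> W n \<subseteq> G"
    and step: "\<And>n. W (Suc n) \<subseteq> W n \<and> (\<exists>V. openin X V \<and> V \<noteq> {} \<and> V \<subseteq> W n \<and> disjnt V (W (Suc n)))"
    unfolding P_def Q_def by simp_all
  from step obtain V where V: "\<And>n. openin X (V n) \<and> V n \<noteq> {} \<and> V n \<subseteq> W n \<and> disjnt (V n) (W (Suc n))"
    by metis
  have anti: "W j \<subseteq> W i" if "i \<le> j" for i j
    using that step by (induction rule: dec_induct) auto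
  have "disjnt (V i) (V j)" if "i < j" for i j
    using V[of i] V[of j] anti[of "Suc i" j] that by (auto simp: disjnt_iff)
  then have "disjnt (V i) (V j)" if "i \<noteq> j" for i j
    using that by (metis disjnt_sym nat_neq_iff)
  then show thesis
    using that[of V] V W by blast
qed

section \<open>Local densities and countable suprema\<close>

text \<open>For open \<open>V\<close> and dense \<open>E\<close> this bounds the density of the
  subspace \<open>E \<inter> V\<close> from below, with density in \<open>V\<close> tested on open
  subsets of \<open>V\<close>.\<close>

definition local_density_ge :: "'a topology \<Rightarrow> 'a set \<Rightarrow> 'a set \<Rightarrow> 'b rel \<Rightarrow> bool" where
  "local_density_ge X E V \<kappa> \<longleftrightarrow>
     (\<forall>C. C \<subseteq> E \<inter> V \<and> (\<forall>U. openin X U \<and> U \<noteq> {} \<and> U \<subseteq> V \<longrightarrow> C \<inter> U \<noteq> {}) \<longrightarrow> \<kappa> \<le>o |C| )"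

lemma local_density_ge_mono:
  "local_density_ge X E V \<kappa> \<Longrightarrow> \<mu> \<le>o \<kappa> \<Longrightarrow> local_density_ge X E V \<mu>"
  unfolding local_density_ge_def using ordLeq_transitive by blast

text \<open>The glued set copies \<open>E (n i)\<close> on \<open>V i\<close>. A dense subset of it
  is dense in each \<open>V i\<close>, so it inherits all the local lower bounds at once.\<close>

lemma dense_subsets_glue:
  assumes "\<And>n. E n \<in> dense_subsets X"
    and "\<And>i. i \<in> N \<Longrightarrow> openin X (V i)"
    and "\<And>i j. i \<in> N \<Longrightarrow> j \<in> N \<Longrightarrow> i \<noteq> j \<Longrightarrow> disjnt (V i) (V j)"
    and "\<And>i. i \<in> N \<Longrightarrow> local_density_ge X (E (n i)) (V i) (\<kappa> i)"
  obtains D where "D \<in> dense_subsets X" "D \<subseteq> (\<Union>n. E n)"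
    "\<And>C i. C \<in> dense_subsets X \<Longrightarrow> C \<subseteq> D \<Longrightarrow> i \<in> N \<Longrightarrow> \<kappa> i \<le>o |C|"
proof -
  let ?V = "\<Union>i\<in>N. V i"
  \<comment> \<open>Off the closure of the \<open>V i\<close> any \<open>E n\<close> will do;
    \<open>undefined\<close> is just some index.\<close>
  define D where "D = (\<Union>i\<in>N. E (n i) \<inter> V i) \<union> (E undefined - X closure_of ?V)"
  have "openin X ?V"
    using assms(2) by blast
  then have V_cl: "?V \<subseteq> X closure_of ?V"
    by (simp add: closure_of_subset openin_subset)
  have D: "D \<in> dense_subsets X"
    unfolding dense_subsets_iff
  proof (intro conjI allI impI)
    show "D \<subseteq> topspace X"
      using assms(1) unfolding D_def dense_subsets_iff by blast
    fix U assume U: "openin X U \<and> U \<noteq> {}"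
    show "D \<inter> U \<noteq> {}"
    proof (cases "U \<inter> ?V = {}")
      case True
      then have "U \<inter> X closure_of ?V = {}"
        using U by (simp add: openin_Int_closure_of_eq_empty)
      moreover have "E undefined \<inter> U \<noteq> {}"
        using assms(1) U unfolding dense_subsets_iff by blast
      ultimately show ?thesis
        unfolding D_def by blast
    next
      case False
      then obtain i where i: "i \<in> N" "U \<inter> V i \<noteq> {}"
        by blast
      with U assms(2) have "openin X (U \<inter> V i)"
        by blast
      with i assms(1) have "E (n i) \<inter> (U \<inter> V i) \<noteq> {}"
        unfolding dense_subsets_iff by blast
      with i show ?thesis
        unfolding D_def by blast
    qed
  qed
  have "\<kappa> i \<le>o |C|" if C: "C \<in> dense_subsets X" "C \<subseteq> D" and i: "i \<in> N" for C i
  proof -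
    have "D \<inter> V i \<subseteq> E (n i) \<inter> V i"
      using assms(3) i V_cl unfolding D_def disjnt_iff by blast
    then have "C \<inter> V i \<subseteq> E (n i) \<inter> V i"
      using C by blast
    moreover have "(C \<inter> V i) \<inter> U \<noteq> {}" if "openin X U \<and> U \<noteq> {} \<and> U \<subseteq> V i" for U
      using that C(1) unfolding dense_subsets_iff by blast
    ultimately have "\<kappa> i \<le>o |C \<inter> V i|"
      using assms(4)[OF i] unfolding local_density_ge_def by blast
    then show ?thesis
      using card_of_mono1[of "C \<inter> V i" C] ordLeq_transitive by blast
  qed
  then show thesis
    using that[of D] D unfolding D_def by blast
qed

text \<open>
  Either every open subset of some open \<open>G\<close> has arbitrarily large local densities, and any
  disjoint sequence in \<open>G\<close> works, or open sets on which the local densities are bounded form a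
  \<open>\<pi>\<close>-base; a maximal disjoint family of those has at most \<open>\<kappa> 0\<close> members, so the local
  densities on its members must be unbounded in \<open>\<kappa>\<close>.
\<close>
lemma cofinal_local_densities:
  fixes \<kappa> :: "nat \<Rightarrow> 'k rel"
  assumes X: "crowded X" "Hausdorff_space X" "topspace X \<noteq> {}"
    and \<kappa>: "\<And>n. Cinfinite (\<kappa> n)" "\<And>i j. i \<le> j \<Longrightarrow> \<kappa> i \<le>o \<kappa> j" "\<And>i. \<exists>n. \<kappa> i <o \<kappa> n"
    and E: "\<And>n. E n \<in> dense_subsets X" "\<And>n. |E n| \<le>o \<kappa> n"
      "\<And>n C. C \<in> dense_subsets X \<Longrightarrow> C \<subseteq> E n \<Longrightarrow> \<kappa> n \<le>o |C|"
  obtains N V n where "\<And>i. i \<in> N \<Longrightarrow> openin X (V i)"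
    "\<And>i j. i \<in> N \<Longrightarrow> j \<in> N \<Longrightarrow> i \<noteq> j \<Longrightarrow> disjnt (V i) (V j)"
    "\<And>i. i \<in> N \<Longrightarrow> local_density_ge X (E (n i)) (V i) (\<kappa> i)"
    "\<And>l. \<exists>i\<in>N. l \<le> i"
proof (cases "\<exists>G. openin X G \<and> G \<noteq> {} \<and> (\<forall>V. openin X V \<and> V \<noteq> {} \<and> V \<subseteq> G \<longrightarrow>
    (\<forall>i. \<exists>n. local_density_ge X (E n) V (\<kappa> i)))")
  case True
  then obtain G where G: "openin X G" "G \<noteq> {}" and large: "\<forall>V. openin X V \<and> V \<noteq> {} \<and> V \<subseteq> G \<longrightarrow>
    (\<forall>i. \<exists>n. local_density_ge X (E n) V (\<kappa> i))"
    by (elim exE conjE)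
  obtain V :: "nat \<Rightarrow> 'a set" where V: "\<And>n. openin X (V n)" "\<And>n. V n \<noteq> {}" "\<And>n. V n \<subseteq> G"
    "\<And>i j. i \<noteq> j \<Longrightarrow> disjnt (V i) (V j)"
    using crowded_Hausdorff_disjoint_open_sequence[OF X(1,2) G] by blast
  then have "\<forall>i. \<exists>n. local_density_ge X (E n) (V i) (\<kappa> i)"
    using large by simp
  then obtain n where "\<And>i. local_density_ge X (E (n i)) (V i) (\<kappa> i)"
    by metis
  with V show thesis
    using that[of UNIV V n] by auto
next
  case False
  define bounded where "bounded V \<longleftrightarrow> (\<exists>i. \<forall>n. \<not> local_density_ge X (E n) V (\<kappa> i))" for V
  have "\<exists>V. openin X V \<and> V \<noteq> {} \<and> V \<subseteq> G \<and> bounded V" if "openin X G" "G \<noteq> {}" for G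
  proof -
    have "\<not> (\<forall>V. openin X V \<and> V \<noteq> {} \<and> V \<subseteq> G \<longrightarrow> (\<forall>i. \<exists>n. local_density_ge X (E n) V (\<kappa> i)))"
      using False that by (meson exI conjI)
    then show ?thesis
      unfolding bounded_def by simp
  qed
  then obtain \<V> where \<V>: "\<And>V. V \<in> \<V> \<Longrightarrow> openin X V \<and> V \<noteq> {} \<and> bounded V"
    and disj: "pairwise disjnt \<V>" and dense: "\<Union>\<V> \<in> dense_subsets X"
    using maximal_disjoint_open_family[of X bounded] by blast
  \<comment> \<open>Members of a disjoint family contain different points of the dense set
    \<open>E 0\<close>.\<close>
  have "|\<V>| \<le>o |E 0|"
  proof -
    have "\<exists>x. x \<in> E 0 \<inter> V" if "V \<in> \<V>" for V
      using \<V>[OF that] E(1)[of 0] unfolding dense_subsets_iff by blast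
    then obtain p where p: "\<And>V. V \<in> \<V> \<Longrightarrow> p V \<in> E 0 \<inter> V"
      by metis
    then have "inj_on p \<V>"
      using disj unfolding inj_on_def pairwise_def disjnt_iff by (metis IntE)
    then show ?thesis
      using p card_of_ordLeq by blast
  qed
  then have card_\<V>: "|\<V>| \<le>o \<kappa> i" for i
    by (rule ordLeq_transitive[OF _ ordLeq_transitive[OF E(2) \<kappa>(2)[OF le0]]])
  \<comment> \<open>Otherwise the union of sets smaller than \<open>\<kappa> i\<close> over the at
    most \<open>\<kappa> i\<close> members of \<open>\<V>\<close> gives, for every \<open>n\<close>,
    a dense subset of \<open>E n\<close> of size at most \<open>\<kappa> i\<close>, although the
    \<open>\<kappa> n\<close> have no largest value.\<close>
  have "\<exists>V\<in>\<V>. \<exists>n. local_density_ge X (E n) V (\<kappa> i)" for i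
  proof (rule ccontr)
    assume "\<not> ?thesis"
    then have no: "\<not> local_density_ge X (E n) V (\<kappa> i)" if "V \<in> \<V>" for V n
      using that by simp
    define Q where "Q V n C \<longleftrightarrow> C \<subseteq> E n \<inter> V \<and>
      (\<forall>U. openin X U \<and> U \<noteq> {} \<and> U \<subseteq> V \<longrightarrow> C \<inter> U \<noteq> {}) \<and> \<not> \<kappa> i \<le>o |C|" for V n C
    define C where "C V n = (SOME C. Q V n C)" for V n
    have "Q V n (C V n)" if "V \<in> \<V>" for V n
    proof -
      have "\<exists>C. Q V n C"
        using no[OF that, of n] unfolding local_density_ge_def Q_def by auto
      then show ?thesis
        unfolding C_def by (rule someI_ex)
    qed
    then have C: "\<And>V n. V \<in> \<V> \<Longrightarrow> C V n \<subseteq> E n \<inter> V"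
      "\<And>V n U. V \<in> \<V> \<Longrightarrow> openin X U \<Longrightarrow> U \<noteq> {} \<Longrightarrow> U \<subseteq> V \<Longrightarrow> C V n \<inter> U \<noteq> {}"
      "\<And>V n. V \<in> \<V> \<Longrightarrow> \<not> \<kappa> i \<le>o |C V n|"
      unfolding Q_def by simp_all
    have "\<kappa> n \<le>o \<kappa> i" for n
    proof -
      have "(\<Union>V\<in>\<V>. C V n) \<in> dense_subsets X"
        unfolding dense_subsets_iff
      proof (intro conjI allI impI)
        show "(\<Union>V\<in>\<V>. C V n) \<subseteq> topspace X"
          using C(1)[of _ n] E(1)[of n] unfolding dense_subsets_iff by blast
        fix U assume U: "openin X U \<and> U \<noteq> {}"
        then obtain V where "V \<in> \<V>" "U \<inter> V \<noteq> {}"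
          using dense unfolding dense_subsets_iff by blast
        with U C(2)[of V "U \<inter> V" n] \<V> show "(\<Union>V\<in>\<V>. C V n) \<inter> U \<noteq> {}"
          by blast
      qed
      moreover have "(\<Union>V\<in>\<V>. C V n) \<subseteq> E n"
        using C(1) by blast
      ultimately have "\<kappa> n \<le>o |\<Union>V\<in>\<V>. C V n|"
        using E(3) by blast
      also have "|\<Union>V\<in>\<V>. C V n| \<le>o \<kappa> i"
        using C(3) \<kappa>(1) card_\<V> by (intro UNION_Cinfinite_bound)
          (auto intro!: ordLeq_if_not_ordLess card_of_Card_order dest: ordLess_imp_ordLeq)
      finally show ?thesis .
    qed
    then show False
      using \<kappa>(3)[of i] not_ordLess_ordLeq by blast
  qed
  then obtain V n where Vn: "\<And>i. V i \<in> \<V>" "\<And>i. local_density_ge X (E (n i)) (V i) (\<kappa> i)"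
    by metis
  \<comment> \<open>The same member may be chosen for many \<open>i\<close>; keeping first
    occurrences makes the sets disjoint.\<close>
  define N where "N = {i. \<forall>j<i. V j \<noteq> V i}"
  have "\<exists>i\<in>N. l \<le> i" for l
  proof (rule ccontr)
    assume l: "\<not> ?thesis"
    obtain b where b: "\<And>W n. W \<in> \<V> \<Longrightarrow> \<not> local_density_ge X (E n) W (\<kappa> (b W))"
      using \<V> unfolding bounded_def by metis
    \<comment> \<open>If all first occurrences come before \<open>l\<close>, only finitely many
      members occur and \<open>m\<close> is at least all their bounds \<open>b\<close>; yet
      \<open>V m\<close> is one of them and has local density at least \<open>\<kappa> m\<close>.
      The inserted 0 serves the case \<open>l = 0\<close>.\<close>
    define m where "m = Max (insert 0 ((b \<circ> V) ` {..<l}))"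
    define j where "j = (LEAST j. V j = V m)"
    have j: "V j = V m"
      unfolding j_def by (rule LeastI[of _ m]) simp
    moreover have "V i \<noteq> V m" if "i < j" for i
      using that not_less_Least unfolding j_def by blast
    ultimately have "j \<in> N"
      unfolding N_def by auto
    then have "j < l"
      using l by force
    then have "b (V j) \<le> m"
      unfolding m_def by (intro Max_ge) auto
    then have "local_density_ge X (E (n m)) (V m) (\<kappa> (b (V j)))"
      using Vn(2)[of m] \<kappa>(2) local_density_ge_mono by blast
    then show False
      using b[of "V j"] Vn(1) j by metis
  qed
  moreover have "disjnt (V i) (V j)" if "i \<in> N" "j \<in> N" "i \<noteq> j" for i j
  proof -
    have "V i \<noteq> V j"
      using that unfolding N_def by (metis (mono_tags, lifting) mem_Collect_eq nat_neq_iff)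
    then show ?thesis
      using disj Vn(1) by (simp add: pairwise_def)
  qed
  ultimately show thesis
    using that[of N V n] Vn \<V> by blast
qed

section \<open>Necessity of the two conditions\<close>

text \<open>A largest element of \<open>A\<close> is its supremum. Otherwise \<open>A\<close> has a
  cofinal increasing sequence, and the dense sets realizing it are glued along disjoint open
  sets.\<close>

lemma omega_closed_if_same_cardinals_dd:
  fixes S :: "'k rel set" and X :: "'x topology"
  assumes S: "\<forall>\<kappa>\<in>S. Cinfinite \<kappa>" and X: "crowded X" "Hausdorff_space X" and dd: "same_cardinals S (dd X)"
  shows "omega_closed S"
  unfolding omega_closed_def
proof (intro allI impI)
  fix A assume A: "A \<subseteq> S \<and> A \<noteq> {} \<and> countable A"
  then have CA: "\<And>\<kappa>. \<kappa> \<in> A \<Longrightarrow> Card_order \<kappa>"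
    using S by blast
  show "\<exists>\<mu>\<in>S. \<mu> =o card_sup A"
  proof (cases "\<exists>\<kappa>\<in>A. \<forall>\<mu>\<in>A. \<mu> \<le>o \<kappa>")
    case True
    then obtain \<kappa> where \<kappa>: "\<kappa> \<in> A" "\<And>\<mu>. \<mu> \<in> A \<Longrightarrow> \<mu> \<le>o \<kappa>"
      by blast
    then have "\<kappa> =o card_sup A"
      unfolding ordIso_iff_ordLeq using CA card_sup(2)[of A] card_sup(3)[of A \<kappa>] by blast
    with \<kappa> A show ?thesis
      by blast
  next
    case False
    define e where "e = from_nat_into A"
    \<comment> \<open>\<open>g n\<close> is the position of the running maximum of
      \<open>e 0\<close>, ..., \<open>e n\<close>, so \<open>\<kappa>\<close> is monotone and
      dominates the enumeration.\<close>
    define g where "g = rec_nat 0 (\<lambda>n k. if e k \<le>o e (Suc n) then Suc n else k)"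
    define \<kappa> where "\<kappa> n = e (g n)" for n
    have g: "g 0 = 0" "g (Suc n) = (if e (g n) \<le>o e (Suc n) then Suc n else g n)" for n
      by (auto simp: g_def)
    have eA: "e n \<in> A" for n
      unfolding e_def using A by (simp add: from_nat_into)
    then have \<kappa>A: "\<kappa> n \<in> A" for n
      unfolding \<kappa>_def by blast
    have e\<kappa>: "e n \<le>o \<kappa> n" for n
    proof (cases n)
      case 0
      then show ?thesis
        using eA[of 0] CA by (simp add: \<kappa>_def g(1) ordLeq_refl)
    next
      case (Suc k)
      then show ?thesis
        using eA CA ordLeq_refl[of "e n"] ordLeq_if_not_ordLess[of "e (g k)" "e n"] ordLess_imp_ordLeq
        by (auto simp: \<kappa>_def g(2))
    qed
    have step: "\<kappa> n \<le>o \<kappa> (Suc n)" for n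
      using \<kappa>A[of n] CA by (auto simp: \<kappa>_def g(2) ordLeq_refl)
    have mono: "\<kappa> i \<le>o \<kappa> j" if "i \<le> j" for i j
      using that
    proof (induction rule: dec_induct)
      case base
      show ?case
        using \<kappa>A CA ordLeq_refl by blast
    next
      case (step n)
      then show ?case
        using \<open>\<And>n. \<kappa> n \<le>o \<kappa> (Suc n)\<close> ordLeq_transitive by blast
    qed
    have cofinal: "\<exists>n. \<mu> \<le>o \<kappa> n" if "\<mu> \<in> A" for \<mu>
      using e\<kappa> that A from_nat_into_surj[of A \<mu>] unfolding e_def by metis
    have unbounded: "\<exists>n. \<kappa> i <o \<kappa> n" for i
    proof -
      obtain \<mu> where \<mu>: "\<mu> \<in> A" "\<not> \<mu> \<le>o \<kappa> i"
        using False \<kappa>A by blast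
      then have "\<kappa> i <o \<mu>"
        using CA \<kappa>A ordLeq_if_not_ordLess by blast
      then show ?thesis
        using cofinal[OF \<mu>(1)] ordLess_ordLeq_trans by blast
    qed
    \<comment> \<open>A dense set of least size in a subspace of density \<open>\<kappa> n\<close>:
      each of its dense subsets is again dense in that subspace, so not smaller.\<close>
    have "\<exists>E. E \<in> dense_subsets X \<and> |E| \<le>o \<kappa> n \<and> (\<forall>C. C \<in> dense_subsets X \<and> C \<subseteq> E \<longrightarrow> \<kappa> n \<le>o |C| )" for n
    proof -
      obtain D where D: "D \<in> dense_subsets X" "\<kappa> n =o density (subtopology X D)"
        using dd \<kappa>A[of n] A unfolding same_cardinals_def dd_def by blast
      obtain E where E: "E \<subseteq> D" "E \<in> dense_subsets X" "density (subtopology X D) = |E|"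
        using density_subtopology_obtains[OF D(1)] .
      have "\<kappa> n \<le>o |C|" if "C \<in> dense_subsets X" "C \<subseteq> E" for C
        using density_subtopology_ordLeq[OF D(1), of C] that E(1) D(2) ordIso_ordLeq_trans by blast
      then show ?thesis
        using E D(2) ordIso_iff_ordLeq by metis
    qed
    then obtain E where E: "\<And>n. E n \<in> dense_subsets X" "\<And>n. |E n| \<le>o \<kappa> n"
      "\<And>n C. C \<in> dense_subsets X \<Longrightarrow> C \<subseteq> E n \<Longrightarrow> \<kappa> n \<le>o |C|"
      by metis
    have inf: "Cinfinite (\<kappa> n)" for n
      using S A \<kappa>A by blast
    \<comment> \<open>In an empty space the empty set is dense, while \<open>\<kappa> 0\<close> is
      infinite.\<close>
    have "topspace X \<noteq> {}"
    proof
      assume "topspace X = {}"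
      then have "{} \<in> dense_subsets X"
        by (simp add: dense_subsets_iff openin_subset)
      then have "\<kappa> 0 \<le>o |{} :: 'x set|"
        using E(3)[of "{}" 0] by blast
      then have "\<kappa> 0 =o (czero :: 'x rel)"
        using inf[of 0] card_of_empty[of "Field (\<kappa> 0)"] card_of_Field_ordIso[of "\<kappa> 0"]
        unfolding czero_def ordIso_iff_ordLeq using ordLeq_transitive by blast
      then show False
        using inf[of 0] cinfinite_not_czero by blast
    qed
    then obtain N V n where NV: "\<And>i. i \<in> N \<Longrightarrow> openin X (V i)"
      "\<And>i j. i \<in> N \<Longrightarrow> j \<in> N \<Longrightarrow> i \<noteq> j \<Longrightarrow> disjnt (V i) (V j)"
      "\<And>i. i \<in> N \<Longrightarrow> local_density_ge X (E (n i)) (V i) (\<kappa> i)" "\<And>l. \<exists>i\<in>N. l \<le> i"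
      using cofinal_local_densities[of X \<kappa> E, OF X _ inf mono unbounded E] by blast
    obtain D where D: "D \<in> dense_subsets X" "D \<subseteq> (\<Union>n. E n)"
      "\<And>C i. C \<in> dense_subsets X \<Longrightarrow> C \<subseteq> D \<Longrightarrow> i \<in> N \<Longrightarrow> \<kappa> i \<le>o |C|"
      using dense_subsets_glue[of E X N V n \<kappa>, OF E(1) NV(1-3)] by blast
    have le_sup: "\<kappa> n \<le>o card_sup A" for n
      using card_sup(2)[of A] CA \<kappa>A by blast
    have "Cinfinite (card_sup A)"
      using le_sup[of 0] inf[of 0] cinfinite_mono card_sup(1)[of A] CA by blast
    moreover have "|E n| \<le>o card_sup A" for n
      by (rule ordLeq_transitive[OF E(2) le_sup])
    \<comment> \<open>The density of \<open>D\<close> is at most the supremum since \<open>D\<close>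
      lies in a countable union of sets of at most this size, and at least the supremum since the
      indices in \<open>N\<close> are unbounded.\<close>
    ultimately have "|\<Union>n. E n| \<le>o card_sup A"
      by (intro card_of_countable_UN_ordLeq) auto
    then have "|D| \<le>o card_sup A"
      using D(2) card_of_mono1 ordLeq_transitive by blast
    moreover have "card_sup A \<le>o |C|" if C: "C \<in> dense_subsets X" "C \<subseteq> D" for C
    proof (rule card_sup_least)
      fix \<mu> assume "\<mu> \<in> A"
      then obtain l where l: "\<mu> \<le>o \<kappa> l"
        using cofinal by blast
      obtain i where i: "i \<in> N" "l \<le> i"
        using NV(4) by blast
      show "\<mu> \<le>o |C|"
        by (rule ordLeq_transitive[OF l ordLeq_transitive[OF mono[OF i(2)] D(3)[OF C i(1)]]])
    qed (use CA card_of_Card_order in auto)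
    ultimately have "card_sup A =o density (subtopology X D)"
      using density_subtopology_ordIsoI[OF D(1) D(1)] by blast
    moreover obtain \<mu> :: "'k rel" where "\<mu> \<in> S" "\<mu> =o density (subtopology X D)"
      using dd D(1) unfolding same_cardinals_def dd_def by blast
    ultimately show ?thesis
      using ordIso_symmetric ordIso_transitive by blast
  qed
qed

text \<open>For a dense set \<open>E\<close> of size \<open>card_min S\<close>, every dense subspace
  has a dense subset of size at most \<open>|Pow E|\<close>, which thus bounds each member of
  \<open>S\<close>.\<close>

lemma card_sup_ordLeq_if_same_cardinals_dd:
  fixes S :: "'k rel set"
  assumes S: "S \<noteq> {}" "\<forall>\<kappa>\<in>S. Cinfinite \<kappa>" and X: "regular_space X" and dd: "same_cardinals S (dd X)"
  shows "card_sup S \<le>o ctwo ^c card_min S"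
proof (rule card_sup_least)
  have "card_min S \<in> S"
    using card_min(1)[of S] S by blast
  then obtain D where D: "D \<in> dense_subsets X" "card_min S =o density (subtopology X D)"
    using dd unfolding same_cardinals_def dd_def by blast
  obtain E where E: "E \<in> dense_subsets X" "density (subtopology X D) = |E|"
    using density_subtopology_obtains[OF D(1)] by metis
  fix \<kappa> assume "\<kappa> \<in> S"
  then obtain D' where D': "D' \<in> dense_subsets X" "\<kappa> =o density (subtopology X D')"
    using dd unfolding same_cardinals_def dd_def by blast
  obtain C where "C \<subseteq> D'" "C \<in> dense_subsets X" "|C| \<le>o |Pow E|"
    using regular_space_dense_ordLeq_Pow[OF X E(1) D'(1)] .
  then have "\<kappa> \<le>o |Pow E|"
    using density_subtopology_ordLeq[OF D'(1)] D'(2) ordIso_ordLeq_trans ordLeq_transitive by blast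
  also have "|Pow E| =o ctwo ^c |E|"
    using card_of_Pow_Func by (auto simp: cexp_def ctwo_def Field_card_of)
  also have "ctwo ^c |E| =o ctwo ^c card_min S"
    using D(2) E(2) S \<open>card_min S \<in> S\<close> by (intro cexp_cong2)
      (auto simp: Card_order_ctwo intro: card_of_Card_order ordIso_symmetric)
  finally show "\<kappa> \<le>o ctwo ^c card_min S" .
qed (use S Card_order_cexp in auto)

section \<open>Spaces with a prescribed double density spectrum\<close>

text \<open>A counting argument: conditions on \<open>n\<close> indices each admit the fraction
  \<open>1 / 2 ^ n\<close> of the assignments on a finite set of indices, and incompatible ones
  admit disjoint sets of assignments, so there are at most \<open>2 ^ n\<close> of them.\<close>

lemma countable_incompatible_conditions:
  assumes fin: "\<And>i. i \<in> I \<Longrightarrow> finite (P i) \<and> finite (N i) \<and> P i \<inter> N i = {}"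
    and incomp: "\<And>i j. i \<in> I \<Longrightarrow> j \<in> I \<Longrightarrow> i \<noteq> j \<Longrightarrow> (P i \<union> P j) \<inter> (N i \<union> N j) \<noteq> {}"
  shows "countable I"
proof -
  have "finite {i \<in> I. card (P i \<union> N i) = n} \<and> card {i \<in> I. card (P i \<union> N i) = n} \<le> 2 ^ n" for n
  proof (rule finite_if_finite_subsets_card_bdd)
    fix G assume G: "G \<subseteq> {i \<in> I. card (P i \<union> N i) = n}" "finite G"
    define W where "W = (\<Union>i\<in>G. P i \<union> N i)"
    \<comment> \<open>Subsets of \<open>W\<close> stand for assignments; \<open>B i\<close> contains
      those that satisfy condition \<open>i\<close>.\<close>
    define B where "B i = (\<union>) (P i) ` Pow (W - (P i \<union> N i))" for i
    have finW: "finite W"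
      unfolding W_def using G fin by auto
    have card_B: "2 ^ n * card (B i) = 2 ^ card W" if "i \<in> G" for i
    proof -
      have sub: "P i \<union> N i \<subseteq> W" "card (P i \<union> N i) = n"
        using that G unfolding W_def by auto
      have "inj_on ((\<union>) (P i)) (Pow (W - (P i \<union> N i)))"
        by (rule inj_onI) blast
      then have "card (B i) = 2 ^ card (W - (P i \<union> N i))"
        unfolding B_def using finW by (simp add: card_image card_Pow)
      also have "card (W - (P i \<union> N i)) = card W - n"
        using sub(2) card_Diff_subset[OF finite_subset[OF sub(1) finW] sub(1)] by simp
      finally show ?thesis
        using sub card_mono[OF finW sub(1)] by (simp flip: power_add)
    qed
    have disj: "B i \<inter> B j = {}" if "i \<in> G" "j \<in> G" "i \<noteq> j" for i j
    proof -
      have "i \<in> I" "j \<in> I"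
        using that G(1) by auto
      then have ij: "P i \<inter> N i = {}" "P j \<inter> N j = {}" "(P i \<union> P j) \<inter> (N i \<union> N j) \<noteq> {}"
        using fin[of i] fin[of j] incomp[of i j] that(3) by simp_all
      have "P i \<subseteq> x \<and> x \<inter> N i = {}" if "x \<in> B i" for x
        using that ij(1) unfolding B_def by auto
      moreover have "P j \<subseteq> x \<and> x \<inter> N j = {}" if "x \<in> B j" for x
        using that ij(2) unfolding B_def by auto
      ultimately show ?thesis
        using ij(3) by blast
    qed
    have "B i \<subseteq> Pow W" if "i \<in> G" for i
      using that unfolding B_def W_def by auto
    then have "card (\<Union>i\<in>G. B i) \<le> card (Pow W)"
      using finW by (intro card_mono) auto
    then have "(\<Sum>i\<in>G. card (B i)) \<le> 2 ^ card W"
      using card_UN_disjoint[of G B] G(2) finW disj by (simp add: card_Pow B_def)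
    then have "2 ^ n * (\<Sum>i\<in>G. card (B i)) \<le> 2 ^ n * 2 ^ card W"
      by simp
    then have "card G * 2 ^ card W \<le> 2 ^ n * 2 ^ card W"
      by (simp add: sum_distrib_left card_B)
    then show "card G \<le> 2 ^ n"
      by simp
  qed
  then have "countable (\<Union>n. {i \<in> I. card (P i \<union> N i) = n})"
    by (intro countable_UN) (auto intro: countable_finite)
  moreover have "I = (\<Union>n. {i \<in> I. card (P i \<union> N i) = n})"
    by auto
  ultimately show ?thesis
    by simp
qed

text \<open>
  Points of the Cantor cube \<open>2^K\<close> are represented as subsets of \<open>K\<close>. The topology on \<open>K\<close> is only
  present through its base \<open>Q\<close>: \<open>Q_avoids\<close> says that \<open>A \<kappa>\<close> is closed.
\<close>
locale spectrum_data =
  fixes K Z :: "'a set" and Q :: "'a set set" and R :: "'k rel set" and m :: "'k rel"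
    and A :: "'k rel \<Rightarrow> 'a set"
  assumes R: "\<kappa> \<in> R \<Longrightarrow> Cinfinite \<kappa>"
    and m_in: "m \<in> R" and m_le: "\<kappa> \<in> R \<Longrightarrow> m \<le>o \<kappa>"
    and Q_subset: "q \<in> Q \<Longrightarrow> q \<subseteq> K" and card_Q: "|Q| \<le>o m"
    and Q_Int: "q \<in> Q \<Longrightarrow> u \<in> Q \<Longrightarrow> q \<inter> u \<in> Q"
    and Q_Diff: "q \<in> Q \<Longrightarrow> u \<in> Q \<Longrightarrow> q - u \<in> Q"
    and Q_separates: "finite P \<Longrightarrow> finite N \<Longrightarrow> P \<subseteq> K \<Longrightarrow> P \<inter> N = {} \<Longrightarrow> \<exists>q\<in>Q. P \<subseteq> q \<and> q \<inter> N = {}"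
    and Q_avoids: "\<kappa> \<in> R \<Longrightarrow> finite F \<Longrightarrow> F \<subseteq> K \<Longrightarrow> F \<inter> A \<kappa> = {} \<Longrightarrow> \<exists>u\<in>Q. F \<subseteq> u \<and> u \<inter> A \<kappa> = {}"
    and Z_subset: "Z \<subseteq> K" and card_Z: "m \<le>o |Z|" and finite_Q_Z: "q \<in> Q \<Longrightarrow> finite (q \<inter> Z)"
    and A_subset: "\<kappa> \<in> R \<Longrightarrow> A \<kappa> \<subseteq> K - Z"
    and A_disjoint: "\<kappa> \<in> R \<Longrightarrow> \<mu> \<in> R \<Longrightarrow> \<kappa> \<noteq> \<mu> \<Longrightarrow> A \<kappa> \<inter> A \<mu> = {}"
    and card_A: "\<kappa> \<in> R \<Longrightarrow> \<kappa> \<noteq> m \<Longrightarrow> |A \<kappa>| =o \<kappa>" and A_m: "A m = {}"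
begin

section \<open>The subspace of the Cantor cube\<close>

definition E :: "'k rel \<Rightarrow> 'a set set" where
  "E \<kappa> = {q - A \<kappa> \<union> F | q F. q \<in> Q \<and> F \<subseteq> A \<kappa> \<and> finite F}"

definition points :: "'a set set" where
  "points = (\<Union>\<kappa>\<in>R. E \<kappa>)"

definition cylinder :: "'a set \<Rightarrow> 'a set \<Rightarrow> 'a set set" where
  "cylinder P N = {x \<in> points. P \<subseteq> x \<and> x \<inter> N = {}}"

text \<open>Among finite pairs, exactly those satisfied by some point. Only \<open>P\<close> is
  confined to \<open>K\<close>: points are subsets of \<open>K\<close>, so elements of
  \<open>N\<close> outside \<open>K\<close> impose nothing.\<close>

definition condition :: "'a set \<Rightarrow> 'a set \<Rightarrow> bool" where
  "condition P N \<longleftrightarrow> finite P \<and> finite N \<and> P \<subseteq> K \<and> P \<inter> N = {}"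

text \<open>The topology that \<open>points\<close> inherits from the product topology of
  \<open>2^K\<close>.\<close>

definition space :: "'a set topology" where
  "space = topology (\<lambda>U. U \<subseteq> points \<and>
     (\<forall>x\<in>U. \<exists>P N. finite P \<and> finite N \<and> x \<in> cylinder P N \<and> cylinder P N \<subseteq> U))"

lemma cylinder_Int: "cylinder P N \<inter> cylinder P' N' = cylinder (P \<union> P') (N \<union> N')"
  unfolding cylinder_def by auto

lemma cylinder_mono: "P \<subseteq> P' \<Longrightarrow> N \<subseteq> N' \<Longrightarrow> cylinder P' N' \<subseteq> cylinder P N"
  unfolding cylinder_def by auto

lemma E_subset: "\<kappa> \<in> R \<Longrightarrow> E \<kappa> \<subseteq> points"
  unfolding points_def by auto

lemma points_subset: "x \<in> points \<Longrightarrow> x \<subseteq> K"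
  unfolding points_def E_def using Q_subset A_subset by blast

lemma condition_if_in_cylinder: "finite P \<Longrightarrow> finite N \<Longrightarrow> x \<in> cylinder P N \<Longrightarrow> condition P N"
  unfolding condition_def cylinder_def using points_subset by blast

text \<open>Inside \<open>A \<kappa>\<close> finitely many values can be prescribed directly,
  outside of it by a separating \<open>q\<close>. Hence \<open>E \<kappa>\<close> is dense and every
  condition is satisfiable.\<close>

lemma E_cylinder:
  assumes "\<kappa> \<in> R" "condition P N"
  shows "E \<kappa> \<inter> cylinder P N \<noteq> {}"
proof -
  obtain q where q: "q \<in> Q" "P \<subseteq> q" "q \<inter> N = {}"
    using assms(2) Q_separates[of P N] unfolding condition_def by auto
  have "finite (P \<inter> A \<kappa>)"
    using assms(2) unfolding condition_def by auto
  then have "q - A \<kappa> \<union> (P \<inter> A \<kappa>) \<in> E \<kappa>"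
    unfolding E_def using q(1) by auto
  moreover from this have "q - A \<kappa> \<union> (P \<inter> A \<kappa>) \<in> cylinder P N"
    using E_subset[OF assms(1)] q assms(2) unfolding cylinder_def condition_def by auto
  ultimately show ?thesis
    by blast
qed

lemma openin_space:
  "openin space U \<longleftrightarrow> U \<subseteq> points \<and>
     (\<forall>x\<in>U. \<exists>P N. finite P \<and> finite N \<and> x \<in> cylinder P N \<and> cylinder P N \<subseteq> U)"
proof -
  define op where "op U \<longleftrightarrow> U \<subseteq> points \<and>
     (\<forall>x\<in>U. \<exists>P N. finite P \<and> finite N \<and> x \<in> cylinder P N \<and> cylinder P N \<subseteq> U)" for U
  have opD: "\<exists>P N. finite P \<and> finite N \<and> x \<in> cylinder P N \<and> cylinder P N \<subseteq> U" if "op U" "x \<in> U" for U x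
    using that unfolding op_def by simp
  have "op (U \<inter> V)" if U: "op U" and V: "op V" for U V
    unfolding op_def
  proof (intro conjI ballI)
    fix x assume x: "x \<in> U \<inter> V"
    then obtain P N where "finite P" "finite N" "x \<in> cylinder P N" "cylinder P N \<subseteq> U"
      using opD[OF U, of x] by auto
    moreover obtain P' N' where "finite P'" "finite N'" "x \<in> cylinder P' N'" "cylinder P' N' \<subseteq> V"
      using opD[OF V, of x] x by auto
    ultimately show "\<exists>P N. finite P \<and> finite N \<and> x \<in> cylinder P N \<and> cylinder P N \<subseteq> U \<inter> V"
      using cylinder_Int[of P N P' N'] by (intro exI[of _ "P \<union> P'"] exI[of _ "N \<union> N'"]) auto
  qed (use U V in \<open>auto simp: op_def\<close>)
  moreover have "op (\<Union>\<U>)" if \<U>: "\<And>U. U \<in> \<U> \<Longrightarrow> op U" for \<U>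
    unfolding op_def
  proof (intro conjI ballI)
    fix x assume "x \<in> \<Union>\<U>"
    then obtain U where U: "U \<in> \<U>" "x \<in> U"
      by blast
    then obtain P N where "finite P" "finite N" "x \<in> cylinder P N" "cylinder P N \<subseteq> U"
      using opD[OF \<U>, of U x] by auto
    with U(1) show "\<exists>P N. finite P \<and> finite N \<and> x \<in> cylinder P N \<and> cylinder P N \<subseteq> \<Union>\<U>"
      by blast
  qed (use \<U> in \<open>auto simp: op_def\<close>)
  ultimately have "istopology op"
    unfolding istopology_def by auto
  then have "openin space = op"
    unfolding space_def op_def by (simp add: topology_inverse')
  then show ?thesis
    by (simp add: op_def)
qed

lemma cylinder_empty: "cylinder {} {} = points"
  unfolding cylinder_def by auto

lemma openin_cylinder: "finite P \<Longrightarrow> finite N \<Longrightarrow> openin space (cylinder P N)"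
  unfolding openin_space by (auto simp: cylinder_def)

lemma topspace_space: "topspace space = points"
proof -
  have "openin space points"
    using openin_cylinder[of "{}" "{}"] by (simp add: cylinder_empty)
  moreover have "topspace space \<subseteq> points"
    using openin_topspace[of space] unfolding openin_space by blast
  ultimately show ?thesis
    using openin_subset by blast
qed

lemma open_contains_cylinder:
  assumes "openin space U" "U \<noteq> {}"
  obtains P N where "condition P N" "cylinder P N \<subseteq> U"
proof -
  obtain x where x: "x \<in> U"
    using assms(2) by blast
  then obtain P N where "finite P" "finite N" "x \<in> cylinder P N" "cylinder P N \<subseteq> U"
    using assms(1) unfolding openin_space by blast
  then show thesis
    using that condition_if_in_cylinder by blast
qed

lemma cylinder_nonempty: "condition P N \<Longrightarrow> cylinder P N \<noteq> {}"
  using E_cylinder[OF m_in] by blast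

lemma dense_subsets_space:
  "D \<in> dense_subsets space \<longleftrightarrow> D \<subseteq> points \<and> (\<forall>P N. condition P N \<longrightarrow> D \<inter> cylinder P N \<noteq> {})"
proof
  assume "D \<in> dense_subsets space"
  then show "D \<subseteq> points \<and> (\<forall>P N. condition P N \<longrightarrow> D \<inter> cylinder P N \<noteq> {})"
    unfolding dense_subsets_iff topspace_space
    using openin_cylinder cylinder_nonempty condition_def by auto
next
  assume D: "D \<subseteq> points \<and> (\<forall>P N. condition P N \<longrightarrow> D \<inter> cylinder P N \<noteq> {})"
  have "D \<inter> U \<noteq> {}" if U: "openin space U \<and> U \<noteq> {}" for U
  proof -
    obtain P N where "condition P N" "cylinder P N \<subseteq> U"
      using open_contains_cylinder U by blast
    then show ?thesis
      using D by blast
  qed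
  then show "D \<in> dense_subsets space"
    using D unfolding dense_subsets_iff topspace_space by blast
qed

lemma E_dense: "\<kappa> \<in> R \<Longrightarrow> E \<kappa> \<in> dense_subsets space"
  unfolding dense_subsets_space using E_subset E_cylinder by auto

lemma card_E:
  assumes "\<kappa> \<in> R"
  shows "|E \<kappa>| \<le>o \<kappa>"
proof -
  have "|Fpow (A \<kappa>)| \<le>o \<kappa>"
  proof (cases "\<kappa> = m")
    case True
    have "|Fpow ({} :: 'a set)| <o \<kappa>"
      using R[OF assms] by (intro Cfinite_ordLess_Cinfinite)
        (auto simp: Fpow_def cfinite_def card_of_card_order_on Field_card_of)
    then show ?thesis
      using True A_m ordLess_imp_ordLeq by metis
  next
    case False
    have "infinite (A \<kappa>)"
      using card_A[OF assms False] R[OF assms] Cinfinite_cong ordIso_symmetric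
      unfolding cinfinite_def by (metis Field_card_of)
    then show ?thesis
      by (rule ordLeq_ordIso_trans[OF card_of_Fpow_ordLeq card_A[OF assms False]])
  qed
  then have "|Q \<times> Fpow (A \<kappa>)| \<le>o \<kappa>"
    using R[OF assms] by (intro card_of_Sigma_ordLeq_infinite_Field ordLeq_transitive[OF card_Q m_le[OF assms]])
      (auto simp: cinfinite_def)
  moreover have "E \<kappa> \<subseteq> (\<lambda>(q, F). q - A \<kappa> \<union> F) ` (Q \<times> Fpow (A \<kappa>))"
    unfolding E_def Fpow_def by auto
  then have "|E \<kappa>| \<le>o |Q \<times> Fpow (A \<kappa>)|"
    by (rule surj_imp_ordLeq)
  ultimately show ?thesis
    by (rule ordLeq_transitive[rotated])
qed

section \<open>Local densities in the space\<close>

text \<open>All points are finite on \<open>Z\<close>, and those of \<open>E \<kappa>\<close> are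
  finite on \<open>A \<kappa>\<close>. So fewer than \<open>\<kappa>\<close> of them cover fewer
  than \<open>\<kappa>\<close> indices there, and a condition demanding an uncovered index escapes
  them all.\<close>

lemma small_subset_misses_index:
  assumes "\<kappa> \<in> R" "C \<subseteq> points" "|C| <o \<kappa>" "finite N"
  obtains a where "a \<in> K - N" "\<And>x. x \<in> C \<Longrightarrow> \<kappa> = m \<or> x \<in> E \<kappa> \<Longrightarrow> a \<notin> x"
proof -
  define T where "T = (if \<kappa> = m then Z else A \<kappa>)"
  define C' where "C' = {x \<in> C. \<kappa> = m \<or> x \<in> E \<kappa>}"
  have T: "T \<subseteq> K" "\<kappa> \<le>o |T|"
    unfolding T_def using Z_subset card_Z A_subset[OF assms(1)] ordIso_imp_ordLeq[OF ordIso_symmetric[OF card_A[OF assms(1)]]]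
    by auto
  have "|C'| <o \<kappa>"
    by (rule ordLeq_ordLess_trans[OF card_of_mono1 assms(3)]) (auto simp: C'_def)
  moreover have "finite (x \<inter> T)" if x: "x \<in> C'" for x
  proof (cases "\<kappa> = m")
    case True
    obtain \<mu> where \<mu>: "\<mu> \<in> R" "x \<in> E \<mu>"
      using x assms(2) unfolding C'_def points_def by auto
    then obtain q F where "q \<in> Q" "x = q - A \<mu> \<union> F" "F \<subseteq> A \<mu>"
      unfolding E_def by auto
    \<comment> \<open>\<open>A \<mu>\<close> is disjoint from \<open>Z\<close>, so on
      \<open>Z\<close> the point \<open>x\<close> agrees with \<open>q\<close>.\<close>
    then have "x \<inter> Z \<subseteq> q \<inter> Z"
      using A_subset[OF \<mu>(1)] by auto
    then show ?thesis
      using finite_subset[OF _ finite_Q_Z[OF \<open>q \<in> Q\<close>]] True unfolding T_def by simp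
  next
    case False
    then obtain q F where "x = q - A \<kappa> \<union> F" "F \<subseteq> A \<kappa>" "finite F"
      using x unfolding C'_def E_def by auto
    then have "x \<inter> A \<kappa> \<subseteq> F"
      by auto
    then show ?thesis
      using \<open>finite F\<close> False finite_subset unfolding T_def by auto
  qed
  ultimately have "|\<Union>x\<in>C'. x \<inter> T| <o \<kappa>"
    using R[OF assms(1)] by (intro card_of_UN_finite_ordLess)
  moreover have "|N| <o \<kappa>"
    using R[OF assms(1)] assms(4) by (intro Cfinite_ordLess_Cinfinite)
      (auto simp: cfinite_def card_of_card_order_on Field_card_of)
  ultimately have "|(\<Union>x\<in>C'. x \<inter> T) \<union> N| <o \<kappa>"
    using R[OF assms(1)] by (intro Un_Cinfinite_bound_strict)
  then have "|(\<Union>x\<in>C'. x \<inter> T) \<union> N| <o |T|"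
    using T(2) by (rule ordLess_ordLeq_trans)
  then have "\<not> T \<subseteq> (\<Union>x\<in>C'. x \<inter> T) \<union> N"
    using card_of_mono1 not_ordLess_ordLeq by metis
  then obtain a where "a \<in> T" "a \<notin> (\<Union>x\<in>C'. x \<inter> T)" "a \<notin> N"
    by auto
  then show thesis
    using that[of a] T(1) unfolding C'_def by auto
qed

text \<open>The missed index is taken in \<open>Z\<close>, on which every point is finite, so no
  \<open>E \<kappa>\<close> has to be singled out.\<close>

lemma local_density_ge_m:
  assumes "condition P N" "D \<subseteq> points"
  shows "local_density_ge space D (cylinder P N) m"
  unfolding local_density_ge_def
proof (intro allI impI ordLeq_if_not_ordLess card_of_Card_order notI)
  fix C assume C: "C \<subseteq> D \<inter> cylinder P N \<and>
    (\<forall>U. openin space U \<and> U \<noteq> {} \<and> U \<subseteq> cylinder P N \<longrightarrow> C \<inter> U \<noteq> {})" and small: "|C| <o m"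
  have PN: "finite P" "finite N" "P \<subseteq> K" "P \<inter> N = {}"
    using assms(1) unfolding condition_def by auto
  obtain a where a: "a \<in> K - N" "\<And>x. x \<in> C \<Longrightarrow> a \<notin> x"
    using small_subset_misses_index[OF m_in _ small PN(2)] C assms(2) by auto
  have "condition (insert a P) N"
    using PN a(1) unfolding condition_def by auto
  then have "C \<inter> cylinder (insert a P) N \<noteq> {}"
    using PN by (intro C[THEN conjunct2, rule_format] conjI openin_cylinder cylinder_nonempty cylinder_mono) auto
  then show False
    using a(2) unfolding cylinder_def by auto
qed (use R[OF m_in] in auto)

lemma E_density:
  assumes "\<kappa> \<in> R"
  shows "\<kappa> =o density (subtopology space (E \<kappa>))"
proof (rule density_subtopology_ordIsoI[OF E_dense E_dense order_refl card_E])
  fix C assume C: "C \<in> dense_subsets space" "C \<subseteq> E \<kappa>"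
  show "\<kappa> \<le>o |C|"
  proof (rule ordLeq_if_not_ordLess)
    show "\<not> |C| <o \<kappa>"
    proof
      assume small: "|C| <o \<kappa>"
      obtain a where a: "a \<in> K - {}" "\<And>x. x \<in> C \<Longrightarrow> \<kappa> = m \<or> x \<in> E \<kappa> \<Longrightarrow> a \<notin> x"
        using small_subset_misses_index[OF assms _ small finite.emptyI] C(2) E_subset[OF assms] by auto
      then have "condition {a} {}"
        unfolding condition_def by auto
      then have "C \<inter> cylinder {a} {} \<noteq> {}"
        using C(1) unfolding dense_subsets_space by auto
      then show False
        using a(2) C(2) unfolding cylinder_def by auto
    qed
  qed (use R[OF assms] card_of_Card_order in auto)
qed (fact assms)+

text \<open>Outside \<open>A \<kappa>\<close> a point of \<open>E \<kappa>\<close> agrees with the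
  clopen set \<open>q\<close>. A neighbourhood \<open>u\<close> of the indices avoiding
  \<open>A \<kappa>\<close> thus splits into \<open>q \<inter> u\<close>, where the point is one,
  and \<open>u - q\<close>, where it is zero.\<close>

lemma E_locally_constant:
  assumes \<kappa>: "\<kappa> \<in> R" and x: "x \<in> E \<kappa>" "x \<in> cylinder P N" and PN: "condition P N" "A \<kappa> \<inter> (P \<union> N) = {}"
  obtains v w where "v \<in> Q" "w \<in> Q" "P \<subseteq> v" "v \<subseteq> x" "N \<inter> K \<subseteq> w" "x \<inter> w = {}"
proof -
  obtain q F where q: "q \<in> Q" "x = q - A \<kappa> \<union> F" "F \<subseteq> A \<kappa>"
    using x(1) unfolding E_def by auto
  obtain u where u: "u \<in> Q" "P \<union> N \<inter> K \<subseteq> u" "u \<inter> A \<kappa> = {}"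
    using Q_avoids[OF \<kappa>, of "P \<union> N \<inter> K"] PN unfolding condition_def by auto
  show thesis
  proof (rule that)
    show "q \<inter> u \<in> Q" "u - q \<in> Q"
      using q u Q_Int Q_Diff by auto
    show "P \<subseteq> q \<inter> u" "q \<inter> u \<subseteq> x" "N \<inter> K \<subseteq> u - q" "x \<inter> (u - q) = {}"
      using q u PN(2) x(2) unfolding cylinder_def by auto
  qed
qed

text \<open>The upper bound matching \<open>local_density_ge\<close>, tested only on the cylinders
  inside \<open>V\<close>.\<close>

definition local_density_le :: "'a set set \<Rightarrow> 'a set set \<Rightarrow> 'k rel \<Rightarrow> bool" where
  "local_density_le D V \<kappa> \<longleftrightarrow> (\<exists>C\<subseteq>D \<inter> V. |C| \<le>o \<kappa> \<and>
     (\<forall>P N. condition P N \<and> cylinder P N \<subseteq> V \<longrightarrow> C \<inter> cylinder P N \<noteq> {}))"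

text \<open>
  If every condition below \<open>(P0, N0)\<close> is met by a point of \<open>D\<close> that is locally constant at the
  indices involved, then \<open>m\<close> many points of \<open>D\<close> meet all of them. Otherwise some condition
  \<open>(P, N)\<close> is only met by points of \<open>D\<close> in \<open>E \<kappa>\<close> with \<open>A \<kappa>\<close> meeting \<open>P \<union> N\<close>, that is, for
  finitely many \<open>\<kappa>\<close>.
\<close>
lemma local_density:
  assumes D: "D \<in> dense_subsets space" and PN0: "condition P0 N0"
  obtains P N \<kappa> where "condition P N" "P0 \<subseteq> P" "N0 \<subseteq> N" "\<kappa> \<in> R"
    "local_density_le D (cylinder P N) \<kappa>" "local_density_ge space D (cylinder P N) \<kappa>"
proof -
  define good where "good P N \<longleftrightarrow> (\<exists>\<kappa>\<in>R. \<exists>x\<in>D. x \<in> E \<kappa> \<and> x \<in> cylinder P N \<and> A \<kappa> \<inter> (P \<union> N) = {})" for P N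
  have Dp: "D \<subseteq> points" and Dc: "\<And>P N. condition P N \<Longrightarrow> D \<inter> cylinder P N \<noteq> {}"
    using D unfolding dense_subsets_space by auto
  consider "\<forall>P N. condition P N \<and> P0 \<subseteq> P \<and> N0 \<subseteq> N \<longrightarrow> good P N"
    | P N where "condition P N" "P0 \<subseteq> P" "N0 \<subseteq> N" "\<not> good P N"
    by auto
  then show thesis
  proof cases
    case 1
    \<comment> \<open>One point is chosen for each pair of ring elements on which some point of
      \<open>D\<close> in the cylinder is constantly one and constantly zero; there are at most
      \<open>m\<close> pairs.\<close>
    define W where "W v w = {x \<in> D \<inter> cylinder P0 N0. v \<subseteq> x \<and> x \<inter> w = {}}" for v w
    define C where "C = (\<lambda>(v, w). SOME x. x \<in> W v w) ` {(v, w) \<in> Q \<times> Q. W v w \<noteq> {}}"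
    have some: "(SOME x. x \<in> W v w) \<in> W v w" if "W v w \<noteq> {}" for v w
      using that some_in_eq[of "W v w"] by simp
    have "C \<subseteq> D \<inter> cylinder P0 N0"
    proof
      fix x assume "x \<in> C"
      then obtain v w where "x = (SOME x. x \<in> W v w)" "W v w \<noteq> {}"
        unfolding C_def by auto
      with some have "x \<in> W v w"
        by simp
      then show "x \<in> D \<inter> cylinder P0 N0"
        unfolding W_def by simp
    qed
    moreover have "|C| \<le>o m"
    proof -
      have "C \<subseteq> (\<lambda>(v, w). SOME x. x \<in> W v w) ` (Q \<times> Q)"
        unfolding C_def by auto
      then have "|C| \<le>o |Q \<times> Q|"
        by (rule surj_imp_ordLeq)
      moreover have "|Q \<times> Q| \<le>o m"
        using R[OF m_in] card_Q by (intro card_of_Sigma_ordLeq_infinite_Field) (auto simp: cinfinite_def)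
      ultimately show ?thesis
        by (rule ordLeq_transitive)
    qed
    moreover have "C \<inter> cylinder P N \<noteq> {}" if PN: "condition P N" "cylinder P N \<subseteq> cylinder P0 N0" for P N
    proof -
      \<comment> \<open>The common point \<open>y\<close> shows that the two conditions are
        compatible.\<close>
      obtain y where "y \<in> cylinder P N"
        using cylinder_nonempty[OF PN(1)] by auto
      then have y: "y \<in> cylinder (P \<union> P0) (N \<union> N0)"
        using PN(2) cylinder_Int by blast
      then have cond: "condition (P \<union> P0) (N \<union> N0)"
        using PN(1) PN0 by (intro condition_if_in_cylinder) (auto simp: condition_def)
      then have "good (P \<union> P0) (N \<union> N0)"
        using 1 by auto
      then obtain \<kappa> x where x: "\<kappa> \<in> R" "x \<in> D" "x \<in> E \<kappa>" "x \<in> cylinder (P \<union> P0) (N \<union> N0)"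
        "A \<kappa> \<inter> ((P \<union> P0) \<union> (N \<union> N0)) = {}"
        unfolding good_def by blast
      obtain v w where vw: "v \<in> Q" "w \<in> Q" "P \<union> P0 \<subseteq> v" "v \<subseteq> x" "(N \<union> N0) \<inter> K \<subseteq> w" "x \<inter> w = {}"
        using E_locally_constant[OF x(1,3,4) cond x(5)] .
      have "x \<in> W v w"
        using x(2,4) vw(4,6) cylinder_Int[of P N P0 N0] unfolding W_def by auto
      then have ne: "W v w \<noteq> {}"
        by auto
      let ?z = "SOME x. x \<in> W v w"
      have z: "?z \<in> W v w"
        using some[OF ne] .
      \<comment> \<open>The chosen point satisfies the condition like \<open>x\<close> does:
        \<open>v\<close> covers \<open>P\<close>, and \<open>w\<close> covers the part of
        \<open>N\<close> in \<open>K\<close>, which is all of \<open>N\<close> that a point could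
        contain.\<close>
      then have "?z \<subseteq> K" "?z \<in> points"
        using Dp points_subset unfolding W_def by auto
      then have "?z \<in> cylinder P N"
        using z vw(3,5) unfolding W_def cylinder_def by auto
      moreover have "?z \<in> C"
        unfolding C_def using ne vw(1,2) by (intro image_eqI[of _ _ "(v, w)"]) auto
      ultimately show ?thesis
        by auto
    qed
    ultimately have "local_density_le D (cylinder P0 N0) m"
      unfolding local_density_le_def by (intro exI[of _ C]) auto
    then show thesis
      using that[OF PN0 order_refl order_refl m_in] local_density_ge_m[OF PN0 Dp] by simp
  next
    case (2 P1 N1)
    define L where "L = {\<kappa> \<in> R. A \<kappa> \<inter> (P1 \<union> N1) \<noteq> {}}"
    have L_R: "L \<subseteq> R"
      unfolding L_def by auto
    \<comment> \<open>As the \<open>A \<kappa>\<close> are disjoint, each \<open>\<kappa>\<close> in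
      \<open>L\<close> has its own index in the finite set \<open>P1 \<union> N1\<close>.\<close>
    have "finite L"
    proof (rule inj_on_finite)
      let ?f = "\<lambda>\<kappa>. SOME a. a \<in> A \<kappa> \<inter> (P1 \<union> N1)"
      have f: "?f \<kappa> \<in> A \<kappa> \<inter> (P1 \<union> N1)" if "\<kappa> \<in> L" for \<kappa>
        using that some_in_eq[of "A \<kappa> \<inter> (P1 \<union> N1)"] unfolding L_def by simp
      show "inj_on ?f L"
      proof (rule inj_onI, rule ccontr)
        fix \<kappa> \<mu> assume "\<kappa> \<in> L" "\<mu> \<in> L" "?f \<kappa> = ?f \<mu>" "\<kappa> \<noteq> \<mu>"
        then show False
          using f[of \<kappa>] f[of \<mu>] A_disjoint[of \<kappa> \<mu>] L_R by auto
      qed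
      show "?f ` L \<subseteq> P1 \<union> N1"
        using f by auto
      show "finite (P1 \<union> N1)"
        using 2(1) unfolding condition_def by auto
    qed
    have cover: "\<exists>\<kappa>\<in>L. x \<in> E \<kappa>" if "x \<in> D" "x \<in> cylinder P1 N1" for x
    proof -
      have "x \<in> points"
        using that(1) Dp by auto
      then obtain \<kappa> where "\<kappa> \<in> R" "x \<in> E \<kappa>"
        unfolding points_def by auto
      then show ?thesis
        using 2(4) that unfolding good_def L_def by auto
    qed
    \<comment> \<open>The \<open>\<kappa>\<close> whose \<open>E \<kappa>\<close> still contributes
      points of \<open>D\<close>. A condition with the fewest types is chosen, so that no stronger
      condition loses one.\<close>
    define types where "types P N = {\<kappa> \<in> L. D \<inter> E \<kappa> \<inter> cylinder P N \<noteq> {}}" for P N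
    define below where "below PN \<longleftrightarrow> condition (fst PN) (snd PN) \<and> P1 \<subseteq> fst PN \<and> N1 \<subseteq> snd PN" for PN
    have "below (P1, N1)"
      using 2(1) unfolding below_def by auto
    then obtain PN where PN: "below PN" "\<And>PN'. below PN' \<Longrightarrow> card (types (fst PN) (snd PN)) \<le> card (types (fst PN') (snd PN'))"
      using ex_has_least_nat[of below "(P1, N1)" "\<lambda>PN. card (types (fst PN) (snd PN))"] by auto
    define P N where "P = fst PN" and "N = snd PN"
    have P: "condition P N" "P1 \<subseteq> P" "N1 \<subseteq> N"
      using PN(1) unfolding below_def P_def N_def by auto
    have stable: "types P' N' = types P N" if "condition P' N'" "P \<subseteq> P'" "N \<subseteq> N'" for P' N'
    proof (rule card_seteq)
      show "finite (types P N)"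
        using \<open>finite L\<close> unfolding types_def by auto
      show "types P' N' \<subseteq> types P N"
        using cylinder_mono[OF that(2,3)] unfolding types_def by auto
      show "card (types P N) \<le> card (types P' N')"
        using PN(2)[of "(P', N')"] that P unfolding below_def P_def N_def by auto
    qed
    have sub1: "cylinder P N \<subseteq> cylinder P1 N1"
      using P cylinder_mono by auto
    obtain x where "x \<in> D" "x \<in> cylinder P N"
      using Dc[OF P(1)] by auto
    then have "types P N \<noteq> {}"
      using cover[of x] sub1 unfolding types_def by auto
    moreover have CO: "\<forall>\<kappa>\<in>types P N. Card_order \<kappa>"
      using L_R R unfolding types_def by auto
    ultimately obtain \<kappa> where \<kappa>: "\<kappa> \<in> types P N" "\<And>\<mu>. \<mu> \<in> types P N \<Longrightarrow> \<kappa> \<le>o \<mu>"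
      using exists_minim_Card_order[of "types P N"] by auto
    have \<kappa>R: "\<kappa> \<in> R"
      using \<kappa>(1) L_R unfolding types_def by auto
    \<comment> \<open>By stability, the points of the smallest remaining type are already dense in
      the cylinder.\<close>
    have "|D \<inter> E \<kappa> \<inter> cylinder P N| \<le>o \<kappa>"
      by (rule ordLeq_transitive[OF card_of_mono1 card_E[OF \<kappa>R]]) auto
    moreover have "D \<inter> E \<kappa> \<inter> cylinder P N \<inter> cylinder P' N' \<noteq> {}"
      if PN': "condition P' N'" "cylinder P' N' \<subseteq> cylinder P N" for P' N'
    proof -
      obtain y where "y \<in> cylinder P' N'"
        using cylinder_nonempty[OF PN'(1)] by auto
      then have "y \<in> cylinder (P \<union> P') (N \<union> N')"
        using PN'(2) cylinder_Int by blast
      then have "condition (P \<union> P') (N \<union> N')"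
        using PN'(1) P(1) by (intro condition_if_in_cylinder) (auto simp: condition_def)
      then have "\<kappa> \<in> types (P \<union> P') (N \<union> N')"
        using stable[of "P \<union> P'" "N \<union> N'"] \<kappa>(1) by auto
      then show ?thesis
        using cylinder_Int[of P N P' N'] unfolding types_def by auto
    qed
    ultimately have "local_density_le D (cylinder P N) \<kappa>"
      unfolding local_density_le_def by (intro exI[of _ "D \<inter> E \<kappa> \<inter> cylinder P N"]) auto
    moreover have "local_density_ge space D (cylinder P N) \<kappa>"
      unfolding local_density_ge_def
    proof (intro allI impI ordLeq_if_not_ordLess card_of_Card_order notI)
      fix C assume C: "C \<subseteq> D \<inter> cylinder P N \<and>
        (\<forall>U. openin space U \<and> U \<noteq> {} \<and> U \<subseteq> cylinder P N \<longrightarrow> C \<inter> U \<noteq> {})" and small: "|C| <o \<kappa>"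
      have "finite N"
        using P(1) unfolding condition_def by auto
      \<comment> \<open>\<open>C\<close> is too small for every remaining type, so each type
        \<open>\<mu>\<close> has an index \<open>a \<mu>\<close> missed by the points of
        \<open>C\<close> in \<open>E \<mu>\<close>. Demanding these finitely many indices together
        excludes all of \<open>C\<close>.\<close>
      have "\<exists>a. a \<in> K - N \<and> (\<forall>x\<in>C \<inter> E \<mu>. a \<notin> x)" if "\<mu> \<in> types P N" for \<mu>
      proof -
        have \<mu>: "\<mu> \<in> R"
          using that L_R unfolding types_def by auto
        have Cp: "C \<subseteq> points"
          using C Dp by auto
        have "|C| <o \<mu>"
          by (rule ordLess_ordLeq_trans[OF small \<kappa>(2)[OF that]])
        from small_subset_misses_index[OF \<mu> Cp this \<open>finite N\<close>]
        obtain a where "a \<in> K - N" "\<And>x. x \<in> C \<Longrightarrow> \<mu> = m \<or> x \<in> E \<mu> \<Longrightarrow> a \<notin> x"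
          by metis
        then show ?thesis
          by (intro exI[of _ a]) simp
      qed
      then obtain a where a: "\<And>\<mu>. \<mu> \<in> types P N \<Longrightarrow> a \<mu> \<in> K - N"
        "\<And>\<mu> x. \<mu> \<in> types P N \<Longrightarrow> x \<in> C \<Longrightarrow> x \<in> E \<mu> \<Longrightarrow> a \<mu> \<notin> x"
        by (metis IntI)
      let ?P = "P \<union> a ` types P N"
      have cond: "condition ?P N"
        using P(1) a(1) \<open>finite L\<close> unfolding condition_def types_def by auto
      have "C \<inter> cylinder ?P N \<noteq> {}"
        using cond[unfolded condition_def]
        by (intro C[THEN conjunct2, rule_format] conjI openin_cylinder cylinder_nonempty[OF cond] cylinder_mono) auto
      then obtain x where x: "x \<in> C" "x \<in> cylinder ?P N"
        by auto
      then have "x \<in> D" "x \<in> cylinder P N"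
        using C by auto
      then obtain \<mu> where "\<mu> \<in> L" "x \<in> E \<mu>"
        using cover[of x] sub1 by auto
      then have "\<mu> \<in> types P N"
        using \<open>x \<in> D\<close> \<open>x \<in> cylinder P N\<close> unfolding types_def by auto
      then show False
        using a(2)[OF _ x(1) \<open>x \<in> E \<mu>\<close>] x(2) unfolding cylinder_def by auto
    qed (use R[OF \<kappa>R] in auto)
    ultimately show thesis
      using that[OF P(1) _ _ \<kappa>R] P 2(2,3) by auto
  qed
qed

section \<open>Chain condition, separation and dimension of the space\<close>

text \<open>Cylinders inside disjoint open sets are disjoint, hence come from incompatible
  conditions.\<close>

lemma ccc_space: "ccc space"
  unfolding ccc_def
proof (intro allI impI)
  fix \<U> assume \<U>: "(\<forall>U\<in>\<U>. openin space U \<and> U \<noteq> {}) \<and> pairwise disjnt \<U>"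
  have "\<exists>P N. condition P N \<and> cylinder P N \<subseteq> U" if "U \<in> \<U>" for U
    using that \<U> open_contains_cylinder by metis
  then obtain P N where PN: "\<And>U. U \<in> \<U> \<Longrightarrow> condition (P U) (N U)" "\<And>U. U \<in> \<U> \<Longrightarrow> cylinder (P U) (N U) \<subseteq> U"
    by metis
  show "countable \<U>"
  proof (rule countable_incompatible_conditions)
    fix U V assume UV: "U \<in> \<U>" "V \<in> \<U>" "U \<noteq> V"
    then have "disjnt U V"
      using \<U> by (auto simp: pairwise_def)
    then have "cylinder (P U \<union> P V) (N U \<union> N V) = {}"
      using PN(2)[OF UV(1)] PN(2)[OF UV(2)] cylinder_Int[of "P U" "N U" "P V" "N V"]
      by (auto simp: disjnt_def)
    then have "\<not> condition (P U \<union> P V) (N U \<union> N V)"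
      using cylinder_nonempty by auto
    then show "(P U \<union> P V) \<inter> (N U \<union> N V) \<noteq> {}"
      using PN(1)[OF UV(1)] PN(1)[OF UV(2)] unfolding condition_def by auto
  qed (use PN(1) in \<open>auto simp: condition_def\<close>)
qed

text \<open>As \<open>Z\<close> is infinite, a finite condition leaves some index free, and both
  values at this index occur in the cylinder.\<close>

lemma crowded_space: "crowded space"
  unfolding crowded_def
proof (intro ballI notI)
  fix x assume "openin space {x}"
  then obtain P N where PN: "condition P N" "cylinder P N \<subseteq> {x}"
    using open_contains_cylinder[of "{x}"] by auto
  then have fin: "finite P" "finite N" "P \<subseteq> K" "P \<inter> N = {}"
    unfolding condition_def by auto
  have "infinite Z"
    using card_Z R[OF m_in] cinfinite_mono[of m "|Z|"] by (auto simp: cinfinite_def Field_card_of)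
  then obtain a where a: "a \<in> K" "a \<notin> P \<union> N"
    using Z_subset fin finite_subset[of Z "P \<union> N"] by auto
  have "condition (insert a P) N" "condition P (insert a N)"
    using fin a unfolding condition_def by auto
  then obtain y z where y: "y \<in> cylinder (insert a P) N" and z: "z \<in> cylinder P (insert a N)"
    using cylinder_nonempty by blast
  then have "y \<in> cylinder P N" "z \<in> cylinder P N" "a \<in> y" "a \<notin> z"
    unfolding cylinder_def by auto
  then show False
    using PN(2) by auto
qed

lemma closedin_cylinder:
  assumes "finite P" "finite N"
  shows "closedin space (cylinder P N)"
  unfolding closedin_def topspace_space openin_space
proof (intro conjI ballI)
  fix x assume x: "x \<in> points - cylinder P N"
  show "\<exists>P' N'. finite P' \<and> finite N' \<and> x \<in> cylinder P' N' \<and> cylinder P' N' \<subseteq> points - cylinder P N"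
  proof (cases "P \<subseteq> x")
    case True
    then obtain a where "a \<in> x" "a \<in> N"
      using x unfolding cylinder_def by auto
    then show ?thesis
      using x by (intro exI[of _ "{a}"] exI[of _ "{}"]) (auto simp: cylinder_def)
  next
    case False
    then obtain a where "a \<notin> x" "a \<in> P"
      by auto
    then show ?thesis
      using x by (intro exI[of _ "{}"] exI[of _ "{a}"]) (auto simp: cylinder_def)
  qed
qed (auto simp: cylinder_def)

lemma zero_dimensional_space: "zero_dimensional space"
proof -
  let ?B = "{cylinder P N | P N. finite P \<and> finite N}"
  have "\<forall>B\<in>?B. openin space B \<and> closedin space B"
    using openin_cylinder closedin_cylinder by auto
  moreover have "\<exists>\<C>\<subseteq>?B. \<Union>\<C> = U" if U: "openin space U" for U
  proof -
    have "x \<in> \<Union>{B \<in> ?B. B \<subseteq> U}" if x: "x \<in> U" for x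
    proof -
      obtain P N where "finite P" "finite N" "x \<in> cylinder P N" "cylinder P N \<subseteq> U"
        using U[unfolded openin_space] x by metis
      then show ?thesis
        by auto
    qed
    then have "\<Union>{B \<in> ?B. B \<subseteq> U} = U"
      by auto
    then show ?thesis
      by (intro exI[of _ "{B \<in> ?B. B \<subseteq> U}"]) auto
  qed
  ultimately show ?thesis
    unfolding zero_dimensional_def by (intro exI[of _ ?B]) simp
qed

lemma Hausdorff_space_space: "Hausdorff_space space"
  unfolding Hausdorff_space_def topspace_space
proof (intro allI impI)
  have sep: "\<exists>U V. openin space U \<and> openin space V \<and> x \<in> U \<and> y \<in> V \<and> disjnt U V"
    if "x \<in> points" "y \<in> points" "a \<in> x" "a \<notin> y" for x y a
    using that openin_cylinder[of "{a}" "{}"] openin_cylinder[of "{}" "{a}"]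
    by (intro exI[of _ "cylinder {a} {}"] exI[of _ "cylinder {} {a}"]) (auto simp: cylinder_def disjnt_iff)
  fix x y assume xy: "x \<in> points \<and> y \<in> points \<and> x \<noteq> y"
  then obtain a where "a \<in> x \<and> a \<notin> y \<or> a \<in> y \<and> a \<notin> x"
    by auto
  then show "\<exists>U V. openin space U \<and> openin space V \<and> x \<in> U \<and> y \<in> V \<and> disjnt U V"
    using sep[of x y a] sep[of y x a] xy by (metis disjnt_sym)
qed

section \<open>The spectrum of the space\<close>

text \<open>By the chain condition, a maximal disjoint family of open sets with local density in
  \<open>R\<close> is countable. The density of \<open>D\<close> is the supremum of these local
  densities, which \<open>R\<close> contains up to isomorphism.\<close>

lemma density_in_R:
  assumes "omega_closed R" and D: "D \<in> dense_subsets space"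
  shows "\<exists>\<kappa>\<in>R. \<kappa> =o density (subtopology space D)"
proof -
  define J where "J V \<kappa> \<longleftrightarrow> \<kappa> \<in> R \<and> local_density_le D V \<kappa> \<and> local_density_ge space D V \<kappa>" for V \<kappa>
  have "\<exists>V. openin space V \<and> V \<noteq> {} \<and> V \<subseteq> G \<and> (\<exists>\<kappa>. J V \<kappa>)" if G: "openin space G" "G \<noteq> {}" for G
  proof -
    obtain P0 N0 where PN0: "condition P0 N0" "cylinder P0 N0 \<subseteq> G"
      using open_contains_cylinder[OF G] .
    obtain P N \<kappa> where PN: "condition P N" "P0 \<subseteq> P" "N0 \<subseteq> N" "\<kappa> \<in> R"
      "local_density_le D (cylinder P N) \<kappa>" "local_density_ge space D (cylinder P N) \<kappa>"
      using local_density[OF D PN0(1)] .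
    show ?thesis
      using PN PN0(2) cylinder_mono[OF PN(2,3)] openin_cylinder[of P N] cylinder_nonempty[OF PN(1)]
      unfolding J_def condition_def by (intro exI[of _ "cylinder P N"]) auto
  qed
  then obtain \<V> where \<V>: "\<And>V. V \<in> \<V> \<Longrightarrow> openin space V \<and> V \<noteq> {} \<and> (\<exists>\<kappa>. J V \<kappa>)"
    "pairwise disjnt \<V>" "\<Union>\<V> \<in> dense_subsets space"
    using maximal_disjoint_open_family[of space "\<lambda>V. \<exists>\<kappa>. J V \<kappa>"] by auto
  have "countable \<V>"
    using ccc_space \<V>(1,2) unfolding ccc_def by auto
  have "condition {} {}"
    unfolding condition_def by auto
  then have "\<Union>\<V> \<inter> cylinder {} {} \<noteq> {}"
    using \<V>(3)[unfolded dense_subsets_space] by simp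
  then have "\<V> \<noteq> {}"
    by auto
  define \<kappa> where "\<kappa> V = (SOME \<kappa>. J V \<kappa>)" for V
  have \<kappa>: "J V (\<kappa> V)" if "V \<in> \<V>" for V
    unfolding \<kappa>_def using \<V>(1)[OF that] someI_ex[of "J V"] by auto
  have \<kappa>R: "\<kappa> ` \<V> \<subseteq> R"
    using \<kappa> unfolding J_def by auto
  have "countable (\<kappa> ` \<V>)" "\<kappa> ` \<V> \<noteq> {}"
    using \<open>countable \<V>\<close> \<open>\<V> \<noteq> {}\<close> by auto
  with \<kappa>R have "\<exists>s\<in>R. s =o card_sup (\<kappa> ` \<V>)"
    using assms(1) unfolding omega_closed_def by simp
  then obtain s :: "'k rel" where s: "s \<in> R" "s =o card_sup (\<kappa> ` \<V>)"
    by (rule bexE)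
  have CO: "Card_order \<mu>" if "\<mu> \<in> \<kappa> ` \<V>" for \<mu>
    using that \<kappa>R R by auto
  define C where "C V = (SOME C. C \<subseteq> D \<inter> V \<and> |C| \<le>o \<kappa> V \<and>
     (\<forall>P N. condition P N \<and> cylinder P N \<subseteq> V \<longrightarrow> C \<inter> cylinder P N \<noteq> {}))" for V
  have C: "C V \<subseteq> D \<inter> V \<and> |C V| \<le>o \<kappa> V \<and>
     (\<forall>P N. condition P N \<and> cylinder P N \<subseteq> V \<longrightarrow> C V \<inter> cylinder P N \<noteq> {})" if "V \<in> \<V>" for V
    unfolding C_def by (rule someI_ex) (use \<kappa>[OF that] in \<open>simp add: J_def local_density_le_def\<close>)
  have dense: "(\<Union>V\<in>\<V>. C V) \<in> dense_subsets space"
    unfolding dense_subsets_space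
  proof (intro conjI allI impI)
    show "(\<Union>V\<in>\<V>. C V) \<subseteq> points"
      using C D unfolding dense_subsets_space by blast
    fix P N assume PN: "condition P N"
    then have "\<Union>\<V> \<inter> cylinder P N \<noteq> {}"
      using \<V>(3) unfolding dense_subsets_space by auto
    then obtain V where V: "V \<in> \<V>" "V \<inter> cylinder P N \<noteq> {}"
      by auto
    have "openin space (V \<inter> cylinder P N)"
      using \<V>(1)[OF V(1)] PN openin_cylinder unfolding condition_def by auto
    then obtain P' N' where "condition P' N'" "cylinder P' N' \<subseteq> V \<inter> cylinder P N"
      using open_contains_cylinder V(2) by metis
    then show "(\<Union>V\<in>\<V>. C V) \<inter> cylinder P N \<noteq> {}"
      using C[OF V(1)] V(1) by blast
  qed
  have "s =o density (subtopology space D)"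
  proof (rule density_subtopology_ordIsoI[OF D dense])
    show "(\<Union>V\<in>\<V>. C V) \<subseteq> D"
      using C by blast
    show "|\<Union>V\<in>\<V>. C V| \<le>o s"
    proof (rule card_of_countable_UN_ordLeq[OF R[OF s(1)] \<open>countable \<V>\<close>])
      fix V assume V: "V \<in> \<V>"
      have "\<kappa> V \<le>o card_sup (\<kappa> ` \<V>)"
        using card_sup(2)[of "\<kappa> ` \<V>"] CO V by auto
      then have "\<kappa> V \<le>o s"
        by (rule ordLeq_ordIso_trans[OF _ ordIso_symmetric[OF s(2)]])
      with C[OF V] show "|C V| \<le>o s"
        using ordLeq_transitive[of "|C V|" "\<kappa> V" s] by auto
    qed
    fix B assume B: "B \<in> dense_subsets space" "B \<subseteq> D"
    have "card_sup (\<kappa> ` \<V>) \<le>o |B|"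
    proof (rule card_sup_least)
      fix \<mu> assume "\<mu> \<in> \<kappa> ` \<V>"
      then obtain V where V: "V \<in> \<V>" "\<mu> = \<kappa> V"
        by auto
      have "(B \<inter> V) \<inter> U \<noteq> {}" if U: "openin space U \<and> U \<noteq> {} \<and> U \<subseteq> V" for U
      proof -
        have "B \<inter> U \<noteq> {}"
          using B(1)[unfolded dense_subsets_iff] U by simp
        with U show ?thesis
          by auto
      qed
      moreover have "B \<inter> V \<subseteq> D \<inter> V"
        using B(2) by auto
      ultimately have "\<kappa> V \<le>o |B \<inter> V|"
        using \<kappa>[OF V(1)] unfolding J_def local_density_ge_def by simp
      then show "\<mu> \<le>o |B|"
        unfolding V(2) by (rule ordLeq_transitive[OF _ card_of_mono1[OF Int_lower1]])
    qed (use CO card_of_Card_order in auto)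
    then show "s \<le>o |B|"
      by (rule ordIso_ordLeq_trans[OF s(2)])
  qed
  with s(1) show ?thesis
    by auto
qed

lemma same_cardinals_dd_space:
  assumes "omega_closed R"
  shows "same_cardinals R (dd space)"
  unfolding same_cardinals_def dd_def using E_dense E_density density_in_R[OF assms] by auto

end

section \<open>Counting cardinals and the ring of clopen traces\<close>

text \<open>A cardinal below \<open>|W|\<close> is isomorphic to a proper initial segment of the
  well-order on \<open>W\<close>, hence named by an element of \<open>W\<close>; the name
  \<open>None\<close> is left for \<open>|W|\<close> itself.\<close>

lemma card_of_cardinals_ordLeq:
  fixes R :: "'k rel set" and W :: "'b set"
  assumes W: "infinite W" and R: "\<And>\<kappa>. \<kappa> \<in> R \<Longrightarrow> Card_order \<kappa> \<and> \<kappa> \<le>o |W|"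
    and distinct: "\<And>\<kappa> \<mu>. \<kappa> \<in> R \<Longrightarrow> \<mu> \<in> R \<Longrightarrow> \<kappa> =o \<mu> \<Longrightarrow> \<kappa> = \<mu>"
  shows "|R| \<le>o |W|"
proof -
  define f where "f \<kappa> = (if \<kappa> =o |W| then None
    else Some (SOME a. a \<in> W \<and> \<kappa> =o Restr |W| (underS |W| a)))" for \<kappa> :: "'k rel"
  have ex: "\<exists>a. a \<in> W \<and> \<kappa> =o Restr |W| (underS |W| a)" if "\<kappa> \<in> R" "\<not> \<kappa> =o |W|" for \<kappa>
  proof -
    have "\<kappa> <o |W|"
      using R[OF that(1)] that(2) ordLeq_iff_ordLess_or_ordIso by auto
    moreover have "Well_order |W|" "Well_order \<kappa>"
      using R[OF that(1)] by (auto simp: card_of_Well_order card_order_on_def)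
    ultimately show ?thesis
      using ordLess_iff_ordIso_Restr[of "|W|" \<kappa>] by (auto simp: Field_card_of)
  qed
  have f_Some: "the (f \<kappa>) \<in> W \<and> \<kappa> =o Restr |W| (underS |W| (the (f \<kappa>)))" if "\<kappa> \<in> R" "\<not> \<kappa> =o |W|" for \<kappa>
    using someI_ex[OF ex[OF that]] that(2) unfolding f_def by simp
  have "inj_on f R"
  proof (rule inj_onI)
    fix \<kappa> \<mu> assume R': "\<kappa> \<in> R" "\<mu> \<in> R" and eq: "f \<kappa> = f \<mu>"
    show "\<kappa> = \<mu>"
    proof (cases "\<kappa> =o |W|")
      case True
      then have "\<mu> =o |W|"
        using eq unfolding f_def by (simp split: if_splits)
      then show ?thesis
        by (intro distinct[OF R'] ordIso_transitive[OF True ordIso_symmetric])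
    next
      case False
      then have "\<not> \<mu> =o |W|"
        using eq unfolding f_def by (auto split: if_splits)
      then have "\<mu> =o Restr |W| (underS |W| (the (f \<kappa>)))"
        using f_Some[OF R'(2)] eq by simp
      then show ?thesis
        using distinct[OF R'] f_Some[OF R'(1) False] ordIso_transitive[OF _ ordIso_symmetric] by blast
    qed
  qed
  moreover have "f ` R \<subseteq> {None} \<union> Some ` W"
  proof
    fix y assume "y \<in> f ` R"
    then obtain \<kappa> where \<kappa>: "\<kappa> \<in> R" "y = f \<kappa>"
      by auto
    show "y \<in> {None} \<union> Some ` W"
    proof (cases "\<kappa> =o |W|")
      case True
      then show ?thesis
        using \<kappa>(2) by (simp add: f_def)
    next
      case False
      then have "y = Some (the (f \<kappa>))"
        using \<kappa>(2) by (simp add: f_def)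
      then show ?thesis
        using f_Some[OF \<kappa>(1) False] by auto
    qed
  qed
  ultimately have "|R| \<le>o |{None} \<union> Some ` W|"
    using card_of_ordLeq[of R "{None} \<union> Some ` W"] by auto
  moreover have "|{None} \<union> Some ` W| \<le>o |W|"
  proof (rule Un_Cinfinite_bound)
    show "|{None :: 'b option}| \<le>o |W|"
      using W by (intro card_of_singl_ordLeq) auto
    show "|Some ` W| \<le>o |W|"
      by (rule card_of_image)
    show "Cinfinite |W|"
      using W card_of_Card_order[of W] by (simp add: cinfinite_def Field_card_of)
  qed
  ultimately show ?thesis
    by (rule ordLeq_transitive)
qed

text \<open>\<open>F\<close> collects one point from the symmetric difference of any two distinct
  members of \<open>Y\<close>.\<close>

lemma finite_trace_separates:
  assumes "finite Y" "\<And>a. a \<in> Y \<Longrightarrow> a \<subseteq> M"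
  obtains F where "finite F" "F \<subseteq> M" "\<And>a b. a \<in> Y \<Longrightarrow> b \<in> Y \<Longrightarrow> a \<inter> F = b \<inter> F \<Longrightarrow> a = b"
proof -
  define d where "d a b = (SOME z. z \<in> (a - b) \<union> (b - a))" for a b :: "'a set"
  have d: "d a b \<in> (a - b) \<union> (b - a)" if "a \<noteq> b" for a b
    unfolding d_def by (rule someI_ex) (use that in auto)
  define F where "F = (\<lambda>(a, b). d a b) ` {(a, b) \<in> Y \<times> Y. a \<noteq> b}"
  have "finite F"
    unfolding F_def using assms(1)
    by (intro finite_imageI finite_subset[of "{(a, b) \<in> Y \<times> Y. a \<noteq> b}" "Y \<times> Y"]) auto
  moreover have "F \<subseteq> M"
  proof
    fix z assume "z \<in> F"
    then obtain a b where "a \<in> Y" "b \<in> Y" "a \<noteq> b" "z = d a b"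
      unfolding F_def by auto
    then show "z \<in> M"
      using d[of a b] assms(2)[of a] assms(2)[of b] by auto
  qed
  moreover have "a = b" if "a \<in> Y" "b \<in> Y" "a \<inter> F = b \<inter> F" for a b
  proof (rule ccontr)
    assume "a \<noteq> b"
    then have "d a b \<in> F"
      unfolding F_def using that(1,2) by (intro image_eqI[of _ _ "(a, b)"]) auto
    then show False
      using d[OF \<open>a \<noteq> b\<close>] that(3) by auto
  qed
  ultimately show thesis
    by (rule that)
qed

text \<open>
  The traces on \<open>K\<close> of the compact open subsets of the Cantor cube \<open>Pow M\<close> without its zero.
  Only finitely many singletons belong to such a set, as they converge to zero.
\<close>
definition trace_ring :: "'a set \<Rightarrow> 'a set set \<Rightarrow> 'a set set set" where
  "trace_ring M K = {{a \<in> K. a \<inter> F \<in> G} | F G. F \<in> Fpow M \<and> G \<in> Fpow (Fpow M) \<and> {} \<notin> G}"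

text \<open>A property of traces on \<open>F\<close> replaces the explicit list \<open>G\<close>;
  its failure at the empty set keeps the zero of the cube out.\<close>

lemma trace_ringI:
  assumes "finite F" "F \<subseteq> M" "\<not> T {}"
  shows "{a \<in> K. T (a \<inter> F)} \<in> trace_ring M K"
proof -
  have "{x \<in> Pow F. T x} \<in> Fpow (Fpow M)"
    using assms finite_subset unfolding Fpow_def by auto
  moreover have "{a \<in> K. T (a \<inter> F)} = {a \<in> K. a \<inter> F \<in> {x \<in> Pow F. T x}}"
    by auto
  moreover have "F \<in> Fpow M"
    using assms by (simp add: Fpow_def)
  ultimately show ?thesis
    unfolding trace_ring_def using assms(3)
    by (intro CollectI exI[of _ F] exI[of _ "{x \<in> Pow F. T x}"]) simp
qed

lemma trace_ringE:
  assumes "q \<in> trace_ring M K"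
  obtains F G where "finite F" "F \<subseteq> M" "q = {a \<in> K. a \<inter> F \<in> G}" "{} \<notin> G"
  using assms unfolding trace_ring_def Fpow_def by auto

text \<open>Both sets can be read off from traces on \<open>F \<union> F'\<close>. The requirement
  on \<open>b\<close> keeps zero out: it admits intersections, unions and differences, but not
  complements.\<close>

lemma trace_ring_combine:
  assumes "q \<in> trace_ring M K" "u \<in> trace_ring M K" "\<not> b False False"
  shows "{a \<in> K. b (a \<in> q) (a \<in> u)} \<in> trace_ring M K"
proof -
  obtain F G where q: "finite F" "F \<subseteq> M" "q = {a \<in> K. a \<inter> F \<in> G}" "{} \<notin> G"
    using trace_ringE[OF assms(1)] .
  obtain F' G' where u: "finite F'" "F' \<subseteq> M" "u = {a \<in> K. a \<inter> F' \<in> G'}" "{} \<notin> G'"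
    using trace_ringE[OF assms(2)] .
  have "{a \<in> K. (\<lambda>x. b (x \<inter> F \<in> G) (x \<inter> F' \<in> G')) (a \<inter> (F \<union> F'))} \<in> trace_ring M K"
    using q u assms(3) by (intro trace_ringI) auto
  moreover have "a \<inter> (F \<union> F') \<inter> F = a \<inter> F" "a \<inter> (F \<union> F') \<inter> F' = a \<inter> F'" for a
    by auto
  ultimately show ?thesis
    using q(3) u(3) by (simp cong: conj_cong)
qed

lemma trace_ring_subset: "q \<in> trace_ring M K \<Longrightarrow> q \<subseteq> K"
  unfolding trace_ring_def by auto

lemma trace_ring_Int:
  assumes "q \<in> trace_ring M K" "u \<in> trace_ring M K"
  shows "q \<inter> u \<in> trace_ring M K"
proof -
  have "q \<inter> u = {a \<in> K. a \<in> q \<and> a \<in> u}"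
    using trace_ring_subset[OF assms(1)] by auto
  then show ?thesis
    using trace_ring_combine[OF assms, of "(\<and>)"] by simp
qed

lemma trace_ring_Un:
  assumes "q \<in> trace_ring M K" "u \<in> trace_ring M K"
  shows "q \<union> u \<in> trace_ring M K"
proof -
  have "q \<union> u = {a \<in> K. a \<in> q \<or> a \<in> u}"
    using trace_ring_subset[OF assms(1)] trace_ring_subset[OF assms(2)] by auto
  then show ?thesis
    using trace_ring_combine[OF assms, of "(\<or>)"] by simp
qed

lemma trace_ring_Diff:
  assumes "q \<in> trace_ring M K" "u \<in> trace_ring M K"
  shows "q - u \<in> trace_ring M K"
proof -
  have "q - u = {a \<in> K. a \<in> q \<and> a \<notin> u}"
    using trace_ring_subset[OF assms(1)] by auto
  then show ?thesis
    using trace_ring_combine[OF assms, of "\<lambda>x y. x \<and> \<not> y"] by simp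
qed

lemma card_of_trace_ring:
  assumes "infinite M"
  shows "|trace_ring M K| \<le>o |M|"
proof -
  have "|Fpow M| =o |M|"
    unfolding ordIso_iff_ordLeq
  proof
    show "|M| \<le>o |Fpow M|"
      by (rule card_of_ordLeqI[of "\<lambda>z. {z}"]) (auto simp: Fpow_def)
  qed (rule card_of_Fpow_ordLeq[OF assms])
  moreover from this have "infinite (Fpow M)"
    using assms card_of_ordIso_finite by auto
  ultimately have "|Fpow (Fpow M)| \<le>o |M|"
    using ordLeq_ordIso_trans[OF card_of_Fpow_ordLeq[of "Fpow M"]] by simp
  then have "|Fpow M \<times> Fpow (Fpow M)| \<le>o |M|"
    using assms card_of_Fpow_ordLeq[OF assms] by (intro card_of_Sigma_ordLeq_infinite) auto
  moreover have "trace_ring M K \<subseteq> (\<lambda>(F, G). {a \<in> K. a \<inter> F \<in> G}) ` (Fpow M \<times> Fpow (Fpow M))"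
    unfolding trace_ring_def by auto
  then have "|trace_ring M K| \<le>o |Fpow M \<times> Fpow (Fpow M)|"
    by (rule surj_imp_ordLeq)
  ultimately show ?thesis
    by (rule ordLeq_transitive[rotated])
qed

lemma trace_ring_separates:
  assumes "finite P" "finite N" "P \<subseteq> K" "P \<inter> N = {}" and K: "\<And>a. a \<in> K \<Longrightarrow> a \<subseteq> M \<and> a \<noteq> {}"
  shows "\<exists>q\<in>trace_ring M K. P \<subseteq> q \<and> q \<inter> N = {}"
proof -
  \<comment> \<open>Zero is separated as well, so that no member of \<open>P\<close> has an empty
    trace.\<close>
  have fin: "finite (insert {} (P \<union> N \<inter> K))"
    using assms(1,2) by simp
  have sub: "a \<subseteq> M" if "a \<in> insert {} (P \<union> N \<inter> K)" for a
    using that assms(3) K by auto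
  obtain F where F: "finite F" "F \<subseteq> M" and
    sep: "\<And>a b. a \<in> insert {} (P \<union> N \<inter> K) \<Longrightarrow> b \<in> insert {} (P \<union> N \<inter> K) \<Longrightarrow> a \<inter> F = b \<inter> F \<Longrightarrow> a = b"
    using finite_trace_separates[OF fin sub] by metis
  let ?q = "{a \<in> K. a \<inter> F \<in> (\<lambda>a. a \<inter> F) ` P}"
  have "{} \<notin> (\<lambda>a. a \<inter> F) ` P"
  proof
    assume "{} \<in> (\<lambda>a. a \<inter> F) ` P"
    then obtain a where "a \<in> P" "a \<inter> F = {} \<inter> F"
      by auto
    then have "a = {}"
      using sep[of a "{}"] by simp
    then show False
      using \<open>a \<in> P\<close> K[of a] assms(3) by auto
  qed
  then have "?q \<in> trace_ring M K"
    using F by (intro trace_ringI[of _ _ "\<lambda>x. x \<in> (\<lambda>a. a \<inter> F) ` P"])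
  moreover have "P \<subseteq> ?q"
    using assms(3) by auto
  moreover have "?q \<inter> N = {}"
  proof (rule ccontr)
    assume "?q \<inter> N \<noteq> {}"
    then obtain a b where "a \<in> K" "a \<in> N" "b \<in> P" "a \<inter> F = b \<inter> F"
      by auto
    then have "a = b"
      using sep[of a b] by simp
    then show False
      using \<open>a \<in> N\<close> \<open>b \<in> P\<close> assms(4) by auto
  qed
  ultimately show ?thesis
    by (intro bexI[of _ ?q]) auto
qed

section \<open>Coding the cardinals in the Cantor cube\<close>

text \<open>\<open>K\<close> lies in the cube \<open>Pow M\<close> with \<open>|M| = m\<close>:
  \<open>Z\<close> consists of singletons, and \<open>A \<kappa>\<close> of sets carrying a label
  for \<open>\<kappa>\<close>. The bound on \<open>card_sup S\<close> gives \<open>Pow M\<close>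
  room for the labels and for each \<open>A \<kappa>\<close>.\<close>

lemma spectrum_data_exists:
  fixes S :: "'k rel set"
  assumes "S \<noteq> {}" and S: "\<forall>\<kappa>\<in>S. Cinfinite \<kappa>" and sup: "card_sup S \<le>o ctwo ^c card_min S"
  obtains K Z :: "'k set set" and Q R m A where "spectrum_data K Z Q R m A" "R \<subseteq> S" "\<forall>\<kappa>\<in>S. \<exists>\<rho>\<in>R. \<kappa> =o \<rho>"
proof -
  \<comment> \<open>\<open>S\<close> may contain several orders of the same cardinal;
    \<open>R\<close> keeps one of each.\<close>
  define rep where "rep \<kappa> = (SOME \<rho>. \<rho> \<in> S \<and> \<rho> =o \<kappa>)" for \<kappa> :: "'k rel"
  define R where "R = rep ` S"
  define m where "m = rep (card_min S)"
  define M where "M = Field m"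
  have CO: "Card_order \<kappa>" if "\<kappa> \<in> S" for \<kappa>
    using S that by auto
  have rep: "rep \<kappa> \<in> S \<and> rep \<kappa> =o \<kappa>" if "\<kappa> \<in> S" for \<kappa>
    unfolding rep_def by (rule someI[of _ \<kappa>]) (use that CO ordIso_refl in auto)
  have distinct: "\<kappa> = \<mu>" if R': "\<kappa> \<in> R" "\<mu> \<in> R" and iso: "\<kappa> =o \<mu>" for \<kappa> \<mu>
  proof -
    obtain a b where ab: "a \<in> S" "\<kappa> = rep a" "b \<in> S" "\<mu> = rep b"
      using R' unfolding R_def by auto
    have "a =o \<kappa>"
      using rep[OF ab(1)] ab(2) ordIso_symmetric by auto
    then have "a =o \<mu>"
      using iso by (rule ordIso_transitive)
    moreover have "\<mu> =o b"
      using rep[OF ab(3)] ab(4) by simp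
    ultimately have ab': "a =o b"
      by (rule ordIso_transitive)
    \<comment> \<open>Isomorphic orders give the choice operator equivalent properties, so their
      representatives are equal.\<close>
    have "\<rho> =o a \<longleftrightarrow> \<rho> =o b" for \<rho> :: "'k rel"
      using ordIso_transitive[OF _ ab'] ordIso_transitive[OF _ ordIso_symmetric[OF ab']] by auto
    then show ?thesis
      unfolding ab(2,4) rep_def by simp
  qed
  have min: "card_min S \<in> S" "\<And>\<kappa>. \<kappa> \<in> S \<Longrightarrow> card_min S \<le>o \<kappa>"
    using card_min[of S] assms(1) CO by auto
  have RS: "R \<subseteq> S"
    unfolding R_def using rep by auto
  have mR: "m \<in> R"
    unfolding m_def R_def using min(1) by auto
  have m_le: "m \<le>o \<kappa>" if "\<kappa> \<in> R" for \<kappa>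
    unfolding m_def by (rule ordIso_ordLeq_trans[OF conjunct2[OF rep[OF min(1)]] min(2)]) (use that RS in auto)
  have RC: "Cinfinite \<kappa>" if "\<kappa> \<in> R" for \<kappa>
    using S RS that by auto
  have infM: "infinite M"
    using RC[OF mR] unfolding M_def cinfinite_def by auto
  have cardM: "|M| =o m"
    unfolding M_def using card_of_Field_ordIso RC[OF mR] by auto
  have le_Pow: "\<kappa> \<le>o |Pow M|" if "\<kappa> \<in> R" for \<kappa>
  proof -
    have "\<kappa> \<le>o card_sup S"
      using card_sup(2)[of S] CO RS that by auto
    also have "card_sup S \<le>o ctwo ^c card_min S"
      by (rule sup)
    also have "ctwo ^c card_min S =o ctwo ^c |M|"
    proof (rule cexp_cong2)
      show "card_min S =o |M|"
        using ordIso_transitive[OF cardM, of "card_min S"] rep[OF min(1)] ordIso_symmetric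
        unfolding m_def by auto
    qed (use CO[OF min(1)] Card_order_ctwo card_of_Card_order in auto)
    also have "ctwo ^c |M| =o |Pow M|"
      using ordIso_symmetric[OF card_of_Pow_Func[of M]] by (simp add: cexp_def ctwo_def Field_card_of)
    finally show ?thesis .
  qed
  have "\<exists>B. B \<subseteq> Pow M \<and> |B| =o \<kappa>" if "\<kappa> \<in> R" for \<kappa>
  proof -
    have F: "|Field \<kappa>| =o \<kappa>"
      using card_of_Field_ordIso RC[OF that] by auto
    have "|Field \<kappa>| \<le>o |Pow M|"
      by (rule ordIso_ordLeq_trans[OF F le_Pow[OF that]])
    then obtain B where "B \<subseteq> Pow M" "|Field \<kappa>| =o |B|"
      using internalize_card_of_ordLeq2[of "Field \<kappa>" "Pow M"] by auto
    then show ?thesis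
      using ordIso_transitive[OF ordIso_symmetric F] by auto
  qed
  then obtain B where B: "\<And>\<kappa>. \<kappa> \<in> R \<Longrightarrow> B \<kappa> \<subseteq> Pow M" "\<And>\<kappa>. \<kappa> \<in> R \<Longrightarrow> |B \<kappa>| =o \<kappa>"
    by metis
  \<comment> \<open>This provides the labels \<open>c \<kappa>\<close>, different subsets of
    \<open>M\<close> for different \<open>\<kappa>\<close>.\<close>
  have "|R| \<le>o |Pow M|"
    using infM RC le_Pow distinct by (intro card_of_cardinals_ordLeq) auto
  then obtain c where c: "inj_on c R" "c ` R \<subseteq> Pow M"
    using card_of_ordLeq[of R "Pow M"] by auto
  \<comment> \<open>\<open>p\<close> marks the members of the \<open>A \<kappa>\<close>; below,
    \<open>h0\<close> and \<open>h1\<close> embed two disjoint copies of \<open>M\<close> in the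
    rest.\<close>
  obtain p where p: "p \<in> M"
    using infM by fastforce
  obtain g where g: "bij_betw g M (M - {p})"
    using infinite_imp_bij_betw[OF infM] by auto
  have "|M <+> M| \<le>o |M|"
    using card_of_Plus_infinite1[OF infM ordLeq_refl[OF card_of_Card_order]] ordIso_imp_ordLeq by auto
  then obtain h where h: "inj_on h (M <+> M)" "h ` (M <+> M) \<subseteq> M"
    using card_of_ordLeq[of "M <+> M" M] by auto
  define h0 where "h0 z = g (h (Inl z))" for z
  define h1 where "h1 z = g (h (Inr z))" for z
  have h_in: "h (Inl z) \<in> M" "h (Inr z) \<in> M" if "z \<in> M" for z
    using h(2) that by auto
  have h_eq: "h x = h y \<longleftrightarrow> x = y" if "x \<in> M <+> M" "y \<in> M <+> M" for x y
    using h(1) that by (rule inj_on_eq_iff)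
  have g_eq: "g x = g y \<longleftrightarrow> x = y" if "x \<in> M" "y \<in> M" for x y
    using g that by (auto simp: bij_betw_def inj_on_eq_iff)
  have g_in: "g x \<in> M - {p}" if "x \<in> M" for x
    using g that by (auto simp: bij_betw_def)
  have h_simps: "h0 x = h0 y \<longleftrightarrow> x = y" "h1 x = h1 y \<longleftrightarrow> x = y" "h0 x \<noteq> h1 y" "h1 x \<noteq> h0 y"
    "h0 x \<in> M" "h1 x \<in> M" "h0 x \<noteq> p" "h1 x \<noteq> p" if "x \<in> M" "y \<in> M" for x y
    unfolding h0_def h1_def using that h_in[OF that(1)] h_in[OF that(2)] g_in[OF h_in(1)[OF that(1)]]
      g_in[OF h_in(2)[OF that(1)]] by (simp_all add: g_eq h_eq InlI InrI)
  \<comment> \<open>The first copy of \<open>M\<close> carries the label, which separates different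
    \<open>A \<kappa>\<close>; the second carries \<open>b\<close>, which makes the coding
    injective.\<close>
  define code where "code \<kappa> b = insert p (h0 ` c \<kappa> \<union> h1 ` b)" for \<kappa> b
  define A where "A \<kappa> = (if \<kappa> = m then {} else code \<kappa> ` B \<kappa>)" for \<kappa>
  define Z where "Z = (\<lambda>z. {z}) ` (M - {p})"
  define K where "K = Z \<union> (\<Union>\<kappa>\<in>R. A \<kappa>)"
  have cM: "c \<kappa> \<subseteq> M" if "\<kappa> \<in> R" for \<kappa>
    using c(2) that by auto
  have in_A: "\<exists>b. b \<subseteq> M \<and> a = code \<kappa> b" if "\<kappa> \<in> R" "a \<in> A \<kappa>" for \<kappa> a
  proof -
    have "a \<in> code \<kappa> ` B \<kappa>"
      using that(2) by (cases "\<kappa> = m") (simp_all add: A_def)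
    then show ?thesis
      using B(1)[OF that(1)] by auto
  qed
  have h0_code: "h0 t \<in> code \<kappa> b \<longleftrightarrow> t \<in> c \<kappa>" if "t \<in> M" "b \<subseteq> M" "\<kappa> \<in> R" for t b \<kappa>
    unfolding code_def using that cM[OF that(3)] h_simps by (auto simp: subset_iff image_iff)
  have h1_code: "h1 t \<in> code \<kappa> b \<longleftrightarrow> t \<in> b" if "t \<in> M" "b \<subseteq> M" "\<kappa> \<in> R" for t b \<kappa>
    unfolding code_def using that cM[OF that(3)] h_simps by (auto simp: subset_iff image_iff)
  have code_subset: "code \<kappa> b \<subseteq> M" if "b \<subseteq> M" "\<kappa> \<in> R" for b \<kappa>
    unfolding code_def using that cM[OF that(2)] h_simps p by (auto simp: subset_iff)
  have p_A: "p \<in> a" if "\<kappa> \<in> R" "a \<in> A \<kappa>" for \<kappa> a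
    using in_A[OF that] unfolding code_def by auto
  have KM: "a \<subseteq> M \<and> a \<noteq> {}" if "a \<in> K" for a
  proof (cases "a \<in> Z")
    case True
    then show ?thesis
      unfolding Z_def by auto
  next
    case False
    then obtain \<kappa> where \<kappa>: "\<kappa> \<in> R" "a \<in> A \<kappa>"
      using \<open>a \<in> K\<close> unfolding K_def by auto
    then show ?thesis
      using in_A[OF \<kappa>] code_subset[OF _ \<kappa>(1)] p_A[OF \<kappa>] by auto
  qed
  have sep_types: "\<exists>t\<in>M. t \<in> c \<kappa> \<longleftrightarrow> t \<notin> c \<mu>" if "\<kappa> \<in> R" "\<mu> \<in> R" "\<kappa> \<noteq> \<mu>" for \<kappa> \<mu>
  proof -
    have "c \<kappa> \<noteq> c \<mu>"
      using c(1) that by (simp add: inj_on_eq_iff)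
    then show ?thesis
      using cM[OF that(1)] cM[OF that(2)] by blast
  qed
  \<comment> \<open>The coordinate \<open>p\<close> separates \<open>Z\<close> from
    \<open>A \<kappa>\<close>, and a coordinate \<open>h0 t\<close> at which the labels differ
    separates \<open>A \<mu>\<close> from \<open>A \<kappa>\<close>.\<close>
  have avoid1: "\<exists>u\<in>trace_ring M K. a \<in> u \<and> u \<inter> A \<kappa> = {}" if \<kappa>: "\<kappa> \<in> R" and a: "a \<in> K" "a \<notin> A \<kappa>" for \<kappa> a
  proof (cases "a \<in> Z")
    case True
    then obtain z where z: "z \<in> M" "z \<noteq> p" "a = {z}"
      unfolding Z_def by auto
    let ?u = "{x \<in> K. (\<lambda>y. z \<in> y \<and> p \<notin> y) (x \<inter> {z, p})}"
    have "?u \<in> trace_ring M K"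
      using z p by (intro trace_ringI) auto
    moreover have "a \<in> ?u"
      using a z by auto
    moreover have "?u \<inter> A \<kappa> = {}"
      using p_A[OF \<kappa>] by auto
    ultimately show ?thesis
      by (intro bexI[of _ ?u] conjI)
  next
    case False
    then obtain \<mu> where \<mu>: "\<mu> \<in> R" "a \<in> A \<mu>"
      using a unfolding K_def by auto
    then obtain b where b: "b \<subseteq> M" "a = code \<mu> b"
      using in_A[OF \<mu>] by auto
    have "\<kappa> \<noteq> \<mu>"
      using a(2) \<mu>(2) by auto
    then obtain t where t: "t \<in> M" "t \<in> c \<kappa> \<longleftrightarrow> t \<notin> c \<mu>"
      using sep_types[OF \<kappa> \<mu>(1)] by auto
    have h0t: "h0 t \<in> M" "h0 t \<noteq> p"
      using h_simps[OF t(1) t(1)] by auto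
    have A\<kappa>: "h0 t \<in> x \<longleftrightarrow> t \<in> c \<kappa>" if "x \<in> A \<kappa>" for x
      using in_A[OF \<kappa> that] h0_code[OF t(1) _ \<kappa>] by auto
    have at: "h0 t \<in> a \<longleftrightarrow> t \<in> c \<mu>"
      using h0_code[OF t(1) b(1) \<mu>(1)] b(2) by simp
    show ?thesis
    proof (cases "t \<in> c \<mu>")
      case True
      let ?u = "{x \<in> K. (\<lambda>y. h0 t \<in> y) (x \<inter> {h0 t})}"
      have "?u \<in> trace_ring M K"
        using h0t by (intro trace_ringI) auto
      moreover have "a \<in> ?u" "?u \<inter> A \<kappa> = {}"
        using a at True A\<kappa> t(2) by auto
      ultimately show ?thesis
        by (intro bexI[of _ ?u] conjI)
    next
      case False
      \<comment> \<open>Containing \<open>p\<close> is demanded because the mere absence of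
        \<open>h0 t\<close> also holds at zero.\<close>
      let ?u = "{x \<in> K. (\<lambda>y. p \<in> y \<and> h0 t \<notin> y) (x \<inter> {h0 t, p})}"
      have "?u \<in> trace_ring M K"
        using h0t p by (intro trace_ringI) auto
      moreover have "a \<in> ?u" "?u \<inter> A \<kappa> = {}"
        using a at False A\<kappa> t(2) p_A[OF \<mu>] by auto
      ultimately show ?thesis
        by (intro bexI[of _ ?u] conjI)
    qed
  qed
  have avoid: "\<exists>u\<in>trace_ring M K. F \<subseteq> u \<and> u \<inter> A \<kappa> = {}"
    if "finite F" "F \<subseteq> K" "F \<inter> A \<kappa> = {}" and \<kappa>: "\<kappa> \<in> R" for F \<kappa>
    using that(1-3)
  proof (induction F rule: finite_induct)
    case empty
    have "{} \<in> trace_ring M K"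
      using trace_ringI[of "{}" M "\<lambda>_. False" K] by simp
    then show ?case
      by auto
  next
    case (insert a F)
    then obtain u where u: "u \<in> trace_ring M K" "F \<subseteq> u" "u \<inter> A \<kappa> = {}"
      by auto
    obtain v where v: "v \<in> trace_ring M K" "a \<in> v" "v \<inter> A \<kappa> = {}"
      using avoid1[OF \<kappa>, of a] insert.prems by auto
    show ?case
      using trace_ring_Un[OF u(1) v(1)] u v by (intro bexI[of _ "u \<union> v"]) auto
  qed
  have "spectrum_data K Z (trace_ring M K) R m A"
  proof
    fix \<kappa> assume \<kappa>: "\<kappa> \<in> R"
    show "Cinfinite \<kappa>" "m \<le>o \<kappa>"
      using RC[OF \<kappa>] m_le[OF \<kappa>] by auto
    show "A \<kappa> \<subseteq> K - Z"
      using \<kappa> p_A[OF \<kappa>] unfolding K_def Z_def by auto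
    show "|A \<kappa>| =o \<kappa>" if "\<kappa> \<noteq> m"
    proof -
      have "inj_on (code \<kappa>) (B \<kappa>)"
      proof (rule inj_onI)
        fix b b' assume b: "b \<in> B \<kappa>" "b' \<in> B \<kappa>" "code \<kappa> b = code \<kappa> b'"
        then have sub: "b \<subseteq> M" "b' \<subseteq> M"
          using B(1)[OF \<kappa>] by auto
        have "t \<in> b \<longleftrightarrow> t \<in> b'" if "t \<in> M" for t
          using h1_code[OF that sub(1) \<kappa>] h1_code[OF that sub(2) \<kappa>] b(3) by simp
        then show "b = b'"
          using sub by blast
      qed
      then have "bij_betw (code \<kappa>) (B \<kappa>) (A \<kappa>)"
        using that unfolding A_def by (simp add: bij_betw_def)
      then have "|B \<kappa>| =o |A \<kappa>|"
        using card_of_ordIso by auto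
      then show ?thesis
        by (rule ordIso_transitive[OF ordIso_symmetric B(2)[OF \<kappa>]])
    qed
    show "\<exists>u\<in>trace_ring M K. F \<subseteq> u \<and> u \<inter> A \<kappa> = {}" if "finite F" "F \<subseteq> K" "F \<inter> A \<kappa> = {}" for F
      using avoid[OF that \<kappa>] .
    fix \<mu> assume \<mu>: "\<mu> \<in> R" "\<kappa> \<noteq> \<mu>"
    obtain t where t: "t \<in> M" "t \<in> c \<kappa> \<longleftrightarrow> t \<notin> c \<mu>"
      using sep_types[OF \<kappa> \<mu>] by auto
    show "A \<kappa> \<inter> A \<mu> = {}"
    proof (rule ccontr)
      assume "A \<kappa> \<inter> A \<mu> \<noteq> {}"
      then obtain x where x: "x \<in> A \<kappa>" "x \<in> A \<mu>"
        by auto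
      then have "h0 t \<in> x \<longleftrightarrow> t \<in> c \<kappa>" "h0 t \<in> x \<longleftrightarrow> t \<in> c \<mu>"
        using in_A[OF \<kappa> x(1)] in_A[OF \<mu>(1) x(2)] h0_code[OF t(1) _ \<kappa>] h0_code[OF t(1) _ \<mu>(1)] by auto
      then show False
        using t(2) by simp
    qed
  next
    show "|trace_ring M K| \<le>o m"
      by (rule ordLeq_ordIso_trans[OF card_of_trace_ring[OF infM] cardM])
    have "bij_betw (\<lambda>z. {z}) (M - {p}) Z"
      unfolding Z_def bij_betw_def by auto
    then have "bij_betw ((\<lambda>z. {z}) \<circ> g) M Z"
      by (rule bij_betw_trans[OF g])
    then have "|M| =o |Z|"
      using card_of_ordIso by auto
    then show "m \<le>o |Z|"
      using ordIso_imp_ordLeq[OF ordIso_transitive[OF ordIso_symmetric[OF cardM]]] by auto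
    fix q assume q: "q \<in> trace_ring M K"
    then show "q \<subseteq> K"
      by (rule trace_ring_subset)
    obtain F G where "finite F" "q = {a \<in> K. a \<inter> F \<in> G}" "{} \<notin> G"
      using trace_ringE[OF q] by metis
    \<comment> \<open>A singleton \<open>{z}\<close> with \<open>z\<close> outside \<open>F\<close>
      has empty trace, which \<open>G\<close> excludes.\<close>
    then have "q \<inter> Z \<subseteq> (\<lambda>z. {z}) ` F"
      unfolding Z_def by (auto simp: Int_insert_left split: if_splits)
    then show "finite (q \<inter> Z)"
      using \<open>finite F\<close> finite_surj by auto
    fix u assume "u \<in> trace_ring M K"
    then show "q \<inter> u \<in> trace_ring M K" "q - u \<in> trace_ring M K"
      using q trace_ring_Int trace_ring_Diff by auto
  next
    fix P N assume "finite P" "finite N" "P \<subseteq> K" "P \<inter> N = {}"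
    then show "\<exists>q\<in>trace_ring M K. P \<subseteq> q \<and> q \<inter> N = {}"
      by (rule trace_ring_separates) (rule KM)
  qed (auto simp: mR A_def K_def)
  moreover have "\<forall>\<kappa>\<in>S. \<exists>\<rho>\<in>R. \<kappa> =o \<rho>"
    unfolding R_def using rep ordIso_symmetric by auto
  ultimately show thesis
    using that RS by auto
qed

section \<open>The equivalence\<close>

text \<open>The data are built for a system \<open>R\<close> of representatives, which is again
  omega-closed and whose spectrum is that of \<open>S\<close> up to isomorphism. As \<open>K\<close>
  consists of sets over \<open>'k\<close>, its subsets, the points, have type
  \<open>'k set set\<close>.\<close>

lemma exists_space_with_spectrum:
  fixes S :: "'k rel set"
  assumes "S \<noteq> {}" and S: "\<forall>\<kappa>\<in>S. Cinfinite \<kappa>" and closed: "omega_closed S"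
    and sup: "card_sup S \<le>o ctwo ^c card_min S"
  shows "\<exists>X :: 'k set set topology. crowded X \<and> Hausdorff_space X \<and> zero_dimensional X \<and> ccc X
    \<and> same_cardinals S (dd X)"
proof -
  obtain K Z :: "'k set set" and Q R m A where data: "spectrum_data K Z Q R m A" and RS: "R \<subseteq> S"
    and rep: "\<forall>\<kappa>\<in>S. \<exists>\<rho>\<in>R. \<kappa> =o \<rho>"
    using spectrum_data_exists[OF assms(1) S sup] by metis
  interpret spectrum_data K Z Q R m A
    by (rule data)
  have "omega_closed R"
    unfolding omega_closed_def
  proof (intro allI impI)
    fix B assume "B \<subseteq> R \<and> B \<noteq> {} \<and> countable B"
    then have "B \<subseteq> S \<and> B \<noteq> {} \<and> countable B"
      using RS by auto
    then have "\<exists>\<mu>\<in>S. \<mu> =o card_sup B"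
      using closed unfolding omega_closed_def by simp
    then obtain \<mu> :: "'k rel" where \<mu>: "\<mu> \<in> S" "\<mu> =o card_sup B"
      by (rule bexE)
    then obtain \<rho> :: "'k rel" where \<rho>: "\<rho> \<in> R" "\<mu> =o \<rho>"
      using rep by auto
    then show "\<exists>\<mu>\<in>R. \<mu> =o card_sup B"
      using ordIso_transitive[OF ordIso_symmetric[OF \<rho>(2)] \<mu>(2)] by auto
  qed
  then have R: "same_cardinals R (dd space)"
    by (rule same_cardinals_dd_space)
  have "same_cardinals S (dd space)"
    unfolding same_cardinals_def
  proof (intro conjI ballI)
    fix \<kappa> assume "\<kappa> \<in> S"
    then obtain \<rho> where \<rho>: "\<rho> \<in> R" "\<kappa> =o \<rho>"
      using rep by auto
    then obtain \<mu> where "\<mu> \<in> dd space" "\<rho> =o \<mu>"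
      using R unfolding same_cardinals_def by auto
    then show "\<exists>\<mu>\<in>dd space. \<kappa> =o \<mu>"
      using ordIso_transitive[OF \<rho>(2)] by auto
  next
    fix \<mu> assume "\<mu> \<in> dd space"
    then obtain \<rho> where "\<rho> \<in> R" "\<rho> =o \<mu>"
      using R unfolding same_cardinals_def by auto
    then show "\<exists>\<kappa>\<in>S. \<kappa> =o \<mu>"
      using RS by auto
  qed
  then show ?thesis
    using crowded_space Hausdorff_space_space zero_dimensional_space ccc_space by auto
qed

lemma necessary_conditions:
  fixes S :: "'k rel set" and X :: "'x topology"
  assumes "S \<noteq> {}" "\<forall>\<kappa>\<in>S. Cinfinite \<kappa>"
    and "crowded X" "Hausdorff_space X" "regular_space X" "same_cardinals S (dd X)"
  shows "omega_closed S \<and> card_sup S \<le>o ctwo ^c card_min S"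
  using assms omega_closed_if_same_cardinals_dd card_sup_ordLeq_if_same_cardinals_dd by metis

theorem corollary2p4:
  fixes S :: "'k rel set"
  assumes "S \<noteq> {}" and "\<forall>\<kappa>\<in>S. Cinfinite \<kappa>"
  shows
    "((omega_closed S \<and> card_sup S \<le>o ctwo ^c card_min S)
        \<longleftrightarrow> (\<exists>X :: 'k set set topology. crowded X \<and> Hausdorff_space X \<and> zero_dimensional X \<and> ccc X
               \<and> same_cardinals S (dd X))) \<and>
     ((omega_closed S \<and> card_sup S \<le>o ctwo ^c card_min S)
        \<longleftrightarrow> (\<exists>X :: 'k set set topology. crowded X \<and> Hausdorff_space X \<and> regular_space X
               \<and> same_cardinals S (dd X))) \<and>
     ((\<exists>X :: 'x topology. crowded X \<and> Hausdorff_space X \<and> zero_dimensional X \<and> ccc X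
               \<and> same_cardinals S (dd X))
        \<longrightarrow> omega_closed S \<and> card_sup S \<le>o ctwo ^c card_min S) \<and>
     ((\<exists>X :: 'x topology. crowded X \<and> Hausdorff_space X \<and> regular_space X
               \<and> same_cardinals S (dd X))
        \<longrightarrow> omega_closed S \<and> card_sup S \<le>o ctwo ^c card_min S)"
proof (intro conjI iffI impI)
  assume "omega_closed S \<and> card_sup S \<le>o ctwo ^c card_min S"
  then show zd: "\<exists>X :: 'k set set topology. crowded X \<and> Hausdorff_space X \<and> zero_dimensional X \<and> ccc X
      \<and> same_cardinals S (dd X)"
    using exists_space_with_spectrum[OF assms] by simp
  then show "\<exists>X :: 'k set set topology. crowded X \<and> Hausdorff_space X \<and> regular_space X
      \<and> same_cardinals S (dd X)"
    using zero_dimensional_imp_regular_space by metis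
\<comment> \<open>The remaining directions are necessity, for the carrier \<open>'k set set\<close>
  and for an arbitrary one; zero-dimensional spaces enter as regular ones.\<close>
qed (use necessary_conditions[OF assms] zero_dimensional_imp_regular_space in metis)+

end
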